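(* Let $\sigma$ be a sequence of order $3$ with terms from $\{\mathtt{A^*},\mathtt{A^+},\mathtt{A^-},\mathtt{N},\mathtt{S^*},\mathtt{S^+},\mathtt{S^-}\}$. Then $\sigma$ does not occur as a subsequence of the sepr-sequence of any real symmetric matrix if and only if one of the following statements holds: 1. $\sigma$ does not occur as a subsequence of the sepr-sequence of any (complex) Hermitian matrix. 2. $\sigma=\mathtt{NA^+Z}$ or $\sigma=\mathtt{NA^-Z}$, for some $\mathtt{Z}\in\{\mathtt{N},\mathtt{S^*},\mathtt{S^+},\mathtt{S^-}\}$. 3. $\sigma=\mathtt{NA^+A^*}$.
   Context: Let $B \in \mathbb{C}^{n\times n}$ be Hermitian ($n$ any positive integer; real symmetric matrices are a special case). For $\alpha\subseteq\{1,\dots,n\}$ with $|\alpha|=k\ge 1$, the determinant of the submatrix $B[\alpha]$ lying in the rows and columns indexed by $\alpha$ is a principal minor of order $k$ (it is a real number). The signed enhanced principal rank characteristic sequence (sepr-sequence) of $B$ is $\operatorname{sepr}(B)=t_1t_2\cdots t_n$, where each $t_k$ is one of the seven symbols $\mathtt{A^*},\mathtt{A^+},\mathtt{A^-},\mathtt{N},\mathtt{S^*},\mathtt{S^+},\mathtt{S^-}$, determined as follows: - $t_k=\mathtt{A^*}$ if all order-$k$ principal minors of $B$ are nonzero and there are both positive and negative ones; - $t_k=\mathtt{A^+}$ (respectively $\mathtt{A^-}$) if all order-$k$ principal minors of $B$ are positive (respectively negative); - $t_k=\mathtt{N}$ if all order-$k$ principal minors of $B$ are zero; - $t_k=\mathtt{S^*}$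 if $B$ has a positive, a negative and a zero order-$k$ principal minor; - $t_k=\mathtt{S^+}$ (respectively $\mathtt{S^-}$) if $B$ has both a zero and a nonzero order-$k$ principal minor and all nonzero order-$k$ principal minors are positive (respectively negative). The order of a sequence is its number of terms. A subsequence of $x_1x_2\cdots x_n$ means a block of consecutive terms $x_px_{p+1}\cdots x_q$ with $1\le p\le q\le n$. *)

theory Defs
  imports
    "HOL-Library.Sublist"
    "Jordan_Normal_Form.DL_Submatrix"
    "Jordan_Normal_Form.Schur_Decomposition"
begin

datatype sepr_symbol = A_star | A_plus | A_minus | N | S_star | S_plus | S_minus

definition hermitian_mat :: "complex mat \<Rightarrow> bool" where
  "hermitian_mat B \<longleftrightarrow> square_mat B \<and> mat_adjoint B = B"

definition real_symmetric_mat :: "real mat \<Rightarrow> bool" where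
  "real_symmetric_mat A \<longleftrightarrow> square_mat A \<and> transpose_mat A = A"

text \<open>Rows and columns of a matrix of order \<open>n\<close> are indexed from \<open>0\<close> to \<open>n - 1\<close>.\<close>

definition principal_minors :: "complex mat \<Rightarrow> nat \<Rightarrow> complex set" where
  "principal_minors B k =
     {det (submatrix B \<alpha> \<alpha>) | \<alpha>. \<alpha> \<subseteq> {0..<dim_row B} \<and> card \<alpha> = k}"

text \<open>
  The order on \<^typ>\<open>complex\<close> is the one of \<^theory>\<open>HOL-Library.Complex_Order\<close>: \<open>z > 0\<close> means that \<open>z\<close>
  is real and positive. The principal minors of a Hermitian matrix are real, and for
  \<open>1 \<le> k \<le> dim_row B\<close> there is at least one of order \<open>k\<close>; in that situation the seven alternatives
  are exclusive and exhaustive, and the final \<open>else\<close> means that there are both zero and nonzero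
  minors and that all nonzero ones are negative.
\<close>

definition sepr_term :: "complex mat \<Rightarrow> nat \<Rightarrow> sepr_symbol" where
  "sepr_term B k =
     (let M = principal_minors B k in
      if (\<forall>z\<in>M. z \<noteq> 0) \<and> (\<exists>z\<in>M. z > 0) \<and> (\<exists>z\<in>M. z < 0) then A_star
      else if \<forall>z\<in>M. z > 0 then A_plus
      else if \<forall>z\<in>M. z < 0 then A_minus
      else if \<forall>z\<in>M. z = 0 then N
      else if (\<exists>z\<in>M. z > 0) \<and> (\<exists>z\<in>M. z < 0) \<and> (\<exists>z\<in>M. z = 0) then S_star
      else if (\<exists>z\<in>M. z = 0) \<and> (\<exists>z\<in>M. z \<noteq> 0) \<and> (\<forall>z\<in>M. z \<noteq> 0 \<longrightarrow> z > 0) then S_plus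
      else S_minus)"

definition sepr :: "complex mat \<Rightarrow> sepr_symbol list" where
  "sepr B = map (sepr_term B) [1..<Suc (dim_row B)]"

text \<open>\<^const>\<open>sublist\<close> is the contiguous notion: \<open>sublist \<sigma> xs\<close> says that \<open>\<sigma>\<close> is a block of
  consecutive entries of \<open>xs\<close>.\<close>

definition occurs_hermitian :: "sepr_symbol list \<Rightarrow> bool" where
  "occurs_hermitian \<sigma> \<longleftrightarrow>
     (\<exists>B. hermitian_mat B \<and> dim_row B > 0 \<and> sublist \<sigma> (sepr B))"

definition occurs_real_symmetric :: "sepr_symbol list \<Rightarrow> bool" where
  "occurs_real_symmetric \<sigma> \<longleftrightarrow>
     (\<exists>A. real_symmetric_mat A \<and> dim_row A > 0 \<and> sublist \<sigma> (sepr (map_mat complex_of_real A)))"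

end

theory Submission
  imports Defs
begin

text \<open>
  The classification rests on two facts about the signs of the principal minors of a Hermitian
  matrix, on two further facts about real symmetric matrices, and on a finite list of matrices.

  For Hermitian matrices: if a principal submatrix is nonsingular and becomes singular when the
  index \<open>i\<close> is deleted, then a suitable second deletion \<open>j\<close> gives a minor of the opposite sign
  (\<open>opposite_sign_two_below\<close>); and if the minors of order \<open>k\<close> take both signs, then some minor of
  order \<open>k - 1\<close> and some minor of order \<open>k + 1\<close> have opposite signs
  (\<open>opposite_signs_in_neighbouring_orders\<close>). For three consecutive terms of a sepr-sequence these
  give the condition \<open>hermitian_admissible\<close>, which 251 of the 343 triples satisfy.

  For real symmetric matrices two more configurations are impossible. If all minors of order \<open>k\<close>
  vanish and none of order \<open>k + 1\<close> does, then none of order \<open>k + 2\<close> does, because a Schur complement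
  of order 3 with zero diagonal has determinant \<open>2xyz\<close>. If moreover the minors of order \<open>k + 1\<close> are
  positive, then those of order \<open>k + 2\<close> have constant sign. A sign change would produce a
  nonsingular real symmetric matrix of order \<open>k + 3 \<ge> 5\<close> with diagonal entries of both signs, negative
  minors of order 2 and zero minors of order 3; the combinatorics of the signs of its off-diagonal
  entries decides which minors of order 4 vanish, and a parity count in a set of 5 indices shows
  that the diagonal has constant sign. These two facts exclude the nine exceptional triples.

  The remaining 242 triples occur in the sepr-sequences of the integer matrices listed in
  \<open>witnesses\<close> and of their negatives. So a triple which occurs for some Hermitian matrix is
  admissible, hence exceptional or realized by a real symmetric matrix.

  The tool behind the four facts is the principal pivot transform: when the minor of \<open>\<alpha>\<close> is nonzero,
  there is a matrix \<open>C\<close>, Hermitian up to the sign of two blocks, whose principal minor on \<open>X\<close> is the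
  minor of the symmetric difference of \<open>\<alpha>\<close> and \<open>X\<close> divided by the minor of \<open>\<alpha>\<close>. It contains the
  complementary minors of an inverse and the minors of a Schur complement as special cases, and it
  turns every statement about index sets close to \<open>\<alpha>\<close> into one about small minors of \<open>C\<close>.
\<close>

section \<open>Principal minors by the Leibniz formula\<close>

text \<open>
  Summing over the permutations of the index set itself avoids the renumbering of rows and columns
  that comes with submatrices. The entries are given by a function, so that minors of order 1, 2
  and 3 can be expanded for arbitrary indices.
\<close>
definition principal_minor :: "(nat \<Rightarrow> nat \<Rightarrow> 'a :: comm_ring_1) \<Rightarrow> nat set \<Rightarrow> 'a" where
  "principal_minor f X = (\<Sum>p | p permutes X. of_int (sign p) * (\<Prod>i\<in>X. f i (p i)))"

lemma principal_minor_cong: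
  assumes "\<And>i j. i \<in> X \<Longrightarrow> j \<in> X \<Longrightarrow> f i j = g i j"
  shows "principal_minor f X = principal_minor g X"
  unfolding principal_minor_def using assms
  by (intro sum.cong prod.cong arg_cong2[where f = "(*)"]) (auto simp: permutes_in_image)

lemma principal_minor_hom:
  assumes "\<And>x y. h (x + y) = h x + h y" "\<And>x y. h (x * y) = h x * h y" "h 0 = 0" "h 1 = 1"
    and "\<And>k :: int. h (of_int k) = of_int k"
  shows "principal_minor (\<lambda>i j. h (f i j)) X = h (principal_minor f X)"
proof -
  have sum: "h (sum u A) = (\<Sum>a\<in>A. h (u a))" for u :: "(nat \<Rightarrow> nat) \<Rightarrow> 'a" and A
    by (induction A rule: infinite_finite_induct) (simp_all add: assms)
  have prod: "h (prod u A) = (\<Prod>a\<in>A. h (u a))" for u :: "nat \<Rightarrow> 'a" and A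
    by (induction A rule: infinite_finite_induct) (simp_all add: assms)
  show ?thesis
    unfolding principal_minor_def by (simp add: sum prod assms)
qed

lemma principal_minor_transpose:
  assumes "finite X"
  shows "principal_minor (\<lambda>i j. f j i) X = principal_minor f X"
proof -
  have "principal_minor (\<lambda>i j. f j i) X
      = (\<Sum>p | p permutes X. of_int (sign (Hilbert_Choice.inv p)) * (\<Prod>i\<in>X. f (Hilbert_Choice.inv p i) i))"
    unfolding principal_minor_def
    by (rule sum.reindex_bij_witness[of _ Hilbert_Choice.inv Hilbert_Choice.inv]) (auto simp: permutes_inv inv_inv_eq permutes_bij)
  also have "\<dots> = principal_minor f X"
    unfolding principal_minor_def
  proof (intro sum.cong refl arg_cong2[where f = "(*)"])
    fix p assume "p \<in> {p. p permutes X}"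
    then have p: "p permutes X" by simp
    show "of_int (sign (Hilbert_Choice.inv p)) = (of_int (sign p) :: 'a)"
      using p assms by (simp add: permutes_imp_permutation sign_inverse)
    show "(\<Prod>i\<in>X. f (Hilbert_Choice.inv p i) i) = (\<Prod>i\<in>X. f i (p i))"
      by (rule prod.reindex_bij_witness[of _ p "Hilbert_Choice.inv p"])
        (auto simp: permutes_inverses[OF p] permutes_in_image[OF p] permutes_in_image[OF permutes_inv[OF p]])
  qed
  finally show ?thesis .
qed

text \<open>
  Rows of the identity outside \<open>X\<close> leave only the permutations that move nothing outside \<open>X\<close>. In this
  form all principal minors are determinants of matrices of one fixed order, so that minors of
  different sets can be compared by matrix multiplication.
\<close>
lemma det_rows_from_identity:
  assumes "X \<subseteq> {..<n}"
  shows "det (mat n n (\<lambda>(i, j). if i \<in> X then f i j else if i = j then 1 else 0)) = principal_minor f X"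
    (is "det ?M = _")
proof -
  have sub: "X \<subseteq> {0..<n}" using assms by auto
  have "det ?M = (\<Sum>p | p permutes {0..<n}. of_int (sign p) * (\<Prod>i = 0..<n. ?M $$ (i, p i)))"
    by (subst det_def'[of _ n]) auto
  also have "\<dots> = (\<Sum>p | p permutes X. of_int (sign p) * (\<Prod>i = 0..<n. ?M $$ (i, p i)))"
  proof (rule sum.mono_neutral_right)
    show "finite {p. p permutes {0..<n}}" by (rule finite_permutations) simp
    show "{p. p permutes X} \<subseteq> {p. p permutes {0..<n}}"
      using sub permutes_subset by blast
    show "\<forall>p\<in>{p. p permutes {0..<n}} - {p. p permutes X}.
        of_int (sign p) * (\<Prod>i = 0..<n. ?M $$ (i, p i)) = 0"
    proof
      fix p assume "p \<in> {p. p permutes {0..<n}} - {p. p permutes X}"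
      then have p: "p permutes {0..<n}" and "\<not> p permutes X" by auto
      then obtain i where i: "i \<in> {0..<n}" "i \<notin> X" "p i \<noteq> i"
        by (meson DiffD1 DiffD2 permutes_superset)
      have "p i < n" using permutes_in_image[OF p, of i] i(1) by simp
      then have "?M $$ (i, p i) = 0" using i by auto
      then have "(\<Prod>i = 0..<n. ?M $$ (i, p i)) = 0" using i(1) by (intro prod_zero) auto
      then show "of_int (sign p) * (\<Prod>i = 0..<n. ?M $$ (i, p i)) = 0" by simp
    qed
  qed
  also have "\<dots> = principal_minor f X"
    unfolding principal_minor_def
  proof (intro sum.cong refl arg_cong2[where f = "(*)"])
    fix p assume "p \<in> {p. p permutes X}"
    then have p: "p permutes X" by simp
    have lt: "p i < n" if "i < n" for i
      using permutes_in_image[OF permutes_subset[OF p sub], of i] that by simp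
    have "(\<Prod>i = 0..<n. ?M $$ (i, p i)) = (\<Prod>i\<in>{0..<n}. if i \<in> X then f i (p i) else 1)"
      using p by (intro prod.cong) (auto simp: lt permutes_not_in)
    also have "\<dots> = (\<Prod>i\<in>X. f i (p i))"
      using sub by (simp add: prod.inter_restrict[symmetric] Int_absorb1)
    finally show "(\<Prod>i = 0..<n. ?M $$ (i, p i)) = (\<Prod>i\<in>X. f i (p i))" .
  qed
  finally show ?thesis .
qed

lemma principal_minor_reindex:
  assumes h: "bij_betw h {0..<k} X"
  shows "principal_minor f X = det (mat k k (\<lambda>(i, j). f (h i) (h j)))"
proof -
  let ?I = "{0..<k}"
  have inj: "inj_on h ?I" and img: "h ` ?I = X"
    using h by (auto simp: bij_betw_def)
  have bij: "bij_betw (map_permutation ?I h) {p. p permutes ?I} {p. p permutes X}"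
  proof -
    have "bij_betw (\<lambda>p x. if x \<in> X then h (p (inv_into ?I h x)) else x)
        {p. p permutes ?I} {p. p permutes X}"
      by (rule bij_betw_permutations[OF h])
    also have "(\<lambda>p x. if x \<in> X then h (p (inv_into ?I h x)) else x) = map_permutation ?I h"
      by (simp add: fun_eq_iff map_permutation_def restrict_id_def img)
    finally show ?thesis .
  qed
  have "principal_minor f X = (\<Sum>p | p permutes ?I.
      of_int (sign (map_permutation ?I h p)) * (\<Prod>i\<in>X. f i (map_permutation ?I h p i)))"
    unfolding principal_minor_def by (rule sum.reindex_bij_betw[OF bij, symmetric])
  also have "\<dots> = (\<Sum>p | p permutes ?I. of_int (sign p) * (\<Prod>i\<in>?I. f (h i) (h (p i))))"
  proof (intro sum.cong refl arg_cong2[where f = "(*)"])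
    fix p assume "p \<in> {p. p permutes ?I}"
    then have p: "p permutes ?I" by simp
    show "of_int (sign (map_permutation ?I h p)) = (of_int (sign p) :: 'a)"
      using sign_map_permutation[OF inj p] by simp
    have "(\<Prod>i\<in>X. f i (map_permutation ?I h p i))
        = (\<Prod>i\<in>?I. f (h i) (map_permutation ?I h p (h i)))"
      by (rule prod.reindex_bij_betw[OF h, symmetric])
    also have "\<dots> = (\<Prod>i\<in>?I. f (h i) (h (p i)))"
      by (intro prod.cong refl) (simp add: map_permutation_apply inj)
    finally show "(\<Prod>i\<in>X. f i (map_permutation ?I h p i)) = (\<Prod>i\<in>?I. f (h i) (h (p i)))" .
  qed
  also have "\<dots> = det (mat k k (\<lambda>(i, j). f (h i) (h j)))"
  proof (subst det_def'[of _ k], simp, intro sum.cong refl arg_cong2[where f = "(*)"] prod.cong)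
    fix p i assume "p \<in> {p. p permutes ?I}" "i \<in> ?I"
    then have "i < k" "p i < k" using permutes_in_image[of p ?I i] by auto
    then show "f (h i) (h (p i)) = mat k k (\<lambda>(i, j). f (h i) (h j)) $$ (i, p i)" by simp
  qed
  finally show ?thesis .
qed

lemma bij_betw_pick:
  assumes "finite X"
  shows "bij_betw (pick X) {0..<card X} X"
proof -
  have inj: "inj_on (pick X) {0..<card X}"
    by (rule linorder_inj_onI) (auto, metis pick_mono_le less_irrefl)
  have "pick X ` {0..<card X} \<subseteq> X"
    using pick_in_set_le by fastforce
  moreover have "card (pick X ` {0..<card X}) = card X"
    using card_image[OF inj] by simp
  ultimately have "pick X ` {0..<card X} = X"
    using assms card_subset_eq by blast
  with inj show ?thesis by (simp add: bij_betw_def)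
qed

lemma det_submatrix:
  assumes "B \<in> carrier_mat n n" "X \<subseteq> {..<n}"
  shows "det (submatrix B X X) = principal_minor (\<lambda>i j. B $$ (i, j)) X"
proof -
  have fin: "finite X" using assms finite_subset by blast
  have eq: "{i. i < n \<and> i \<in> X} = X" using assms by auto
  have "submatrix B X X = mat (card X) (card X) (\<lambda>(i, j). B $$ (pick X i, pick X j))"
    using assms(1) eq by (simp add: submatrix_def)
  then show ?thesis
    using principal_minor_reindex[OF bij_betw_pick[OF fin], of "\<lambda>i j. B $$ (i, j)"] by simp
qed

lemma principal_minor_empty [simp]: "principal_minor f {} = 1"
  by (simp add: principal_minor_def sign_id)


lemma principal_minor_singleton [simp]: "principal_minor f {i} = f i i"
  by (simp add: principal_minor_def sign_id)

lemma principal_minor_2: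
  assumes "i \<noteq> j"
  shows "principal_minor f {i, j} = f i i * f j j - f i j * f j i"
proof -
  have "principal_minor f {i, j} = (\<Sum>b\<in>{i, j}.
      of_int (sign (transpose i b)) * (f i (transpose i b i) * f j (transpose i b j)))"
    unfolding principal_minor_def using assms
    by (subst sum_over_permutations_insert) simp_all
  then show ?thesis using assms by (simp add: sign_swap_id)
qed

lemma principal_minor_3:
  assumes "i \<noteq> j" "i \<noteq> k" "j \<noteq> k"
  shows "principal_minor f {i, j, k} =
    f i i * f j j * f k k + f i j * f j k * f k i + f i k * f j i * f k j
    - f i i * f j k * f k j - f i j * f j i * f k k - f i k * f j j * f k i"
proof -
  have "permutation (transpose a b)" for a b :: nat
    by (rule permutation_swap_id)
  note [simp] = this sign_compose
  have "principal_minor f {i, j, k} = (\<Sum>b\<in>{i, j, k}. \<Sum>c\<in>{j, k}.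
      of_int (sign (transpose i b) * sign (transpose j c)) *
      (f i (transpose i b i) * (f j (transpose i b (transpose j c j)) * f k (transpose i b (transpose j c k)))))"
    unfolding principal_minor_def using assms
    by (simp add: sum_over_permutations_insert)
  also have "\<dots> = f i i * (f j j * f k k) - f i i * (f j k * f k j)
      + (- (f i j * (f j i * f k k)) + f i j * (f j k * f k i))
      + (- (f i k * (f j j * f k i)) + f i k * (f j i * f k j))"
    using assms by (simp add: sign_swap_id)
  finally show ?thesis by (simp add: algebra_simps)
qed

lemma principal_minor_zero_row:
  assumes "finite X" "i \<in> X" "\<And>j. j \<in> X \<Longrightarrow> f i j = 0"
  shows "principal_minor f X = 0"
  unfolding principal_minor_def
proof (rule sum.neutral, rule ballI)
  fix p assume "p \<in> {p. p permutes X}"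
  then have "f i (p i) = 0" using assms by (simp add: permutes_in_image)
  then have "(\<Prod>i\<in>X. f i (p i)) = 0" using assms by (intro prod_zero) auto
  then show "of_int (sign p) * (\<Prod>i\<in>X. f i (p i)) = 0" by simp
qed

text \<open>
  The matrix with rows of \<open>X \<union> Y\<close> is the product of the one for \<open>X\<close> and the one for \<open>Y\<close>, once the
  entries that do not matter have been set to zero.
\<close>
lemma principal_minor_block:
  assumes "finite X" "finite Y" "X \<inter> Y = {}"
    and zero: "\<And>i j. i \<in> X \<Longrightarrow> j \<in> Y \<Longrightarrow> f i j = 0"
  shows "principal_minor f (X \<union> Y) = principal_minor f X * principal_minor f Y"
proof -
  obtain n where n: "X \<union> Y \<subseteq> {..<n}"
    using assms(1,2) finite_nat_iff_bounded[of "X \<union> Y"] by blast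
  (* g keeps only the entries of the blocks X by X, Y by X and Y by Y *)
  define g where "g i j = (if i \<in> X \<and> j \<notin> X \<or> i \<in> Y \<and> j \<notin> X \<union> Y then 0 else f i j)" for i j
  define M where "M Z = mat n n (\<lambda>(i, j). if i \<in> Z then g i j else if i = j then 1 else 0)" for Z
  have det: "det (M Z) = principal_minor g Z" if "Z \<subseteq> X \<union> Y" for Z
    unfolding M_def by (rule det_rows_from_identity) (use that n in auto)
  have "M (X \<union> Y) = M X * M Y"
  proof (rule eq_matI)
    fix i j assume "i < dim_row (M X * M Y)" "j < dim_col (M X * M Y)"
    then have ij: "i < n" "j < n" by (simp_all add: M_def)
    have "(M X * M Y) $$ (i, j) = (\<Sum>l = 0..<n. M X $$ (i, l) * M Y $$ (l, j))"
      using ij by (simp add: M_def scalar_prod_def)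
    also have "\<dots> = (if i \<in> X then \<Sum>l = 0..<n. (if l = j then g i j else 0) else M Y $$ (i, j))"
    proof (cases "i \<in> X")
      case True
      have "M X $$ (i, l) * M Y $$ (l, j) = (if l = j then g i j else 0)" if "l < n" for l
        using True that ij assms(3) by (cases "l \<in> Y") (auto simp: M_def g_def)
      then show ?thesis using True by (auto intro!: sum.cong)
    next
      case False
      then have "M X $$ (i, l) * M Y $$ (l, j) = (if l = i then M Y $$ (i, j) else 0)" if "l < n" for l
        using that ij by (auto simp: M_def)
      then have "(\<Sum>l = 0..<n. M X $$ (i, l) * M Y $$ (l, j)) = (\<Sum>l = 0..<n. if l = i then M Y $$ (i, j) else 0)"
        by (intro sum.cong) auto
      then show ?thesis using False ij by simp
    qed
    also have "\<dots> = M (X \<union> Y) $$ (i, j)"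
      using ij by (auto simp: M_def)
    finally show "M (X \<union> Y) $$ (i, j) = (M X * M Y) $$ (i, j)" by simp
  qed (simp_all add: M_def)
  then have "principal_minor g (X \<union> Y) = principal_minor g X * principal_minor g Y"
    using det_mult[of "M X" n "M Y"] det[of "X \<union> Y"] det[of X] det[of Y] by (simp add: M_def)
  moreover have "principal_minor g Z = principal_minor f Z" if "Z = X \<union> Y \<or> Z = X \<or> Z = Y" for Z
    by (rule principal_minor_cong) (use that zero assms(3) in \<open>auto simp: g_def\<close>)
  ultimately show ?thesis by simp
qed

section \<open>The principal pivot transform\<close>

text \<open>
  Write \<open>R Z\<close> for the identity matrix with the rows in \<open>Z\<close> replaced by those of \<open>f\<close>. The transform is
  \<open>C = R (- \<alpha>) * inverse (R \<alpha>)\<close>. Row \<open>i\<close> of \<open>C * R \<alpha>\<close> is the row of \<open>R (- \<alpha>)\<close>, so replacing the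
  rows of the identity in \<open>X\<close> by those of \<open>C\<close> and multiplying by \<open>R \<alpha>\<close> exchanges, inside \<open>X\<close>, the rows of \<open>f\<close>
  and the rows of the identity; this gives the matrix \<open>R\<close> of the symmetric difference. The symmetry
  of \<open>C\<close> comes from the Hermitian form of \<open>f\<close>, evaluated on two columns of the inverse and split into the
  coordinates in \<open>\<alpha>\<close> and those outside.
\<close>
theorem principal_pivot_transform:
  fixes f :: "nat \<Rightarrow> nat \<Rightarrow> 'a :: conjugatable_field"
  assumes herm: "\<forall>i<n. \<forall>j<n. f j i = conjugate (f i j)"
    and \<alpha>: "\<alpha> \<subseteq> {..<n}" and nz: "principal_minor f \<alpha> \<noteq> 0"
  shows "\<exists>c. (\<forall>X \<subseteq> {..<n}.
       principal_minor f (sym_diff \<alpha> X) = principal_minor f \<alpha> * principal_minor c X) \<and>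
    (\<forall>i < n. \<forall>j < n.
       c j i = (if i \<in> \<alpha> \<longleftrightarrow> j \<in> \<alpha> then conjugate (c i j) else - conjugate (c i j)))"
proof -
  define R where "R X = mat n n (\<lambda>(i, j). if i \<in> X then f i j else if i = j then 1 else 0)" for X
  have R: "R X \<in> carrier_mat n n" for X by (simp add: R_def)
  have detR: "det (R X) = principal_minor f X" if "X \<subseteq> {..<n}" for X
    unfolding R_def by (rule det_rows_from_identity[OF that])
  have "R \<alpha> \<in> Units (ring_mat TYPE('a) n ())"
    by (rule det_non_zero_imp_unit[OF R]) (simp add: detR \<alpha> nz)
  then obtain V where V: "V \<in> carrier_mat n n" and VR: "V * R \<alpha> = 1\<^sub>m n" and RV: "R \<alpha> * V = 1\<^sub>m n"
    unfolding Units_def ring_mat_def by auto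
  have detV: "principal_minor f \<alpha> * det V = 1"
    using det_mult[OF R V, of \<alpha>] RV detR[OF \<alpha>] by simp
  define C where "C = R ({..<n} - \<alpha>) * V"
  have C: "C \<in> carrier_mat n n" unfolding C_def using R V by (rule mult_carrier_mat)
  define c where "c i j = C $$ (i, j)" for i j
  have entry: "(R Z * V) $$ (i, j) = (if i \<in> Z then \<Sum>l = 0..<n. f i l * V $$ (l, j) else V $$ (i, j))"
    if "i < n" "j < n" for Z i j
  proof -
    have "(R Z * V) $$ (i, j) = (\<Sum>l = 0..<n. R Z $$ (i, l) * V $$ (l, j))"
      using that V by (simp add: R_def scalar_prod_def)
    also have "\<dots> = (\<Sum>l = 0..<n. if i \<in> Z then f i l * V $$ (l, j) else if l = i then V $$ (i, j) else 0)"
      using that by (intro sum.cong refl) (auto simp: R_def)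
    finally show ?thesis using that by simp
  qed
  have unit: "(if i \<in> \<alpha> then \<Sum>l = 0..<n. f i l * V $$ (l, j) else V $$ (i, j)) = (if i = j then 1 else 0)"
    if "i < n" "j < n" for i j
    using entry[OF that, of \<alpha>] that by (simp add: RV)
  have c_eq: "c i j = (if i \<in> \<alpha> then V $$ (i, j) else \<Sum>l = 0..<n. f i l * V $$ (l, j))"
    if "i < n" "j < n" for i j
    using entry[OF that, of "{..<n} - \<alpha>"] that by (simp add: c_def C_def)
  show ?thesis
  proof (intro exI[of _ c] conjI allI impI)
    fix X assume X: "X \<subseteq> {..<n}"
    have "R (sym_diff \<alpha> X) * V = mat n n (\<lambda>(i, j). if i \<in> X then c i j else if i = j then 1 else 0)"
    proof (rule eq_matI)
      fix i j
      assume "i < dim_row (mat n n (\<lambda>(i, j). if i \<in> X then c i j else if i = j then 1 else 0))"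
        "j < dim_col (mat n n (\<lambda>(i, j). if i \<in> X then c i j else if i = j then 1 else 0))"
      then have ij: "i < n" "j < n" by simp_all
      show "(R (sym_diff \<alpha> X) * V) $$ (i, j)
          = mat n n (\<lambda>(i, j). if i \<in> X then c i j else if i = j then 1 else 0) $$ (i, j)"
        using entry[OF ij, of "sym_diff \<alpha> X"] unit[OF ij] c_eq[OF ij] ij by auto
    qed (use V in \<open>simp_all add: R_def\<close>)
    then have "det (R (sym_diff \<alpha> X)) * det V = principal_minor c X"
      using det_mult[OF R V, of "sym_diff \<alpha> X"] det_rows_from_identity[OF X, of c] by simp
    then have "principal_minor f (sym_diff \<alpha> X) * det V = principal_minor c X"
      by (subst detR[symmetric]) (use \<alpha> X in auto)
    then show "principal_minor f (sym_diff \<alpha> X) = principal_minor f \<alpha> * principal_minor c X"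
      using detV by (metis mult.assoc mult.commute mult.right_neutral)
  next
    fix i j assume ij: "i < n" "j < n"
    (* u is the inverse and w its product with f: on each row, one of the two is a row of C
       and the other a row of the identity *)
    define u where "u k l = V $$ (k, l)" for k l
    define w where "w k l = (\<Sum>m = 0..<n. f k m * u m l)" for k l
    have cu: "c k l = (if k \<in> \<alpha> then u k l else w k l)"
      and wu: "(if k \<in> \<alpha> then w k l else u k l) = (if k = l then 1 else 0)" if "k < n" "l < n" for k l
      using c_eq[OF that] unit[OF that] unfolding u_def w_def by blast+
    have "(\<Sum>k = 0..<n. conjugate (u k i) * w k j) = (\<Sum>k = 0..<n. \<Sum>m = 0..<n. conjugate (u k i) * f k m * u m j)"
      by (simp add: w_def sum_distrib_left mult.assoc)
    also have "\<dots> = (\<Sum>m = 0..<n. \<Sum>k = 0..<n. conjugate (u k i) * f k m * u m j)"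
      by (rule sum.swap)
    also have "\<dots> = (\<Sum>m = 0..<n. \<Sum>k = 0..<n. conjugate (f m k * u k i) * u m j)"
    proof (intro sum.cong refl)
      fix m k assume "m \<in> {0..<n}" "k \<in> {0..<n}"
      then have "f k m = conjugate (f m k)" using herm by (metis atLeastLessThan_iff)
      then show "conjugate (u k i) * f k m * u m j = conjugate (f m k * u k i) * u m j"
        by (simp add: conjugate_dist_mul mult.commute)
    qed
    also have "\<dots> = (\<Sum>m = 0..<n. conjugate (w m i) * u m j)"
      by (simp add: w_def sum_conjugate sum_distrib_right)
    finally have form: "(\<Sum>k = 0..<n. conjugate (u k i) * w k j) = (\<Sum>k = 0..<n. conjugate (w k i) * u k j)" .
    have "conjugate (1 * conjugate (1::'a)) = conjugate 1"
      by (simp only: conjugate_dist_mul conjugate_id mult_1_right)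
    then have [simp]: "conjugate (1::'a) = 1" by simp
    have l: "conjugate (u k i) * w k j
        = (if k = j \<and> j \<in> \<alpha> then conjugate (c j i) else 0) + (if k = i \<and> i \<notin> \<alpha> then c i j else 0)"
      if "k < n" for k
      using cu[of k i] cu[of k j] wu[of k i] wu[of k j] that ij by (auto split: if_splits)
    have r: "conjugate (w k i) * u k j
        = (if k = i \<and> i \<in> \<alpha> then c i j else 0) + (if k = j \<and> j \<notin> \<alpha> then conjugate (c j i) else 0)"
      if "k < n" for k
      using cu[of k i] cu[of k j] wu[of k i] wu[of k j] that ij by (auto split: if_splits)
    have delta: "(\<Sum>k = 0..<n. if k = a \<and> P then x else 0) = (if P then x else (0::'a))" if "a < n" for a P x
      using that by (cases P) simp_all
    have "(\<Sum>k = 0..<n. conjugate (u k i) * w k j)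
        = (\<Sum>k = 0..<n. (if k = j \<and> j \<in> \<alpha> then conjugate (c j i) else 0) + (if k = i \<and> i \<notin> \<alpha> then c i j else 0))"
      by (intro sum.cong refl l) simp
    moreover have "(\<Sum>k = 0..<n. conjugate (w k i) * u k j)
        = (\<Sum>k = 0..<n. (if k = i \<and> i \<in> \<alpha> then c i j else 0) + (if k = j \<and> j \<notin> \<alpha> then conjugate (c j i) else 0))"
      by (intro sum.cong refl r) simp
    ultimately have "(if j \<in> \<alpha> then conjugate (c j i) else 0) + (if i \<notin> \<alpha> then c i j else 0)
        = (if i \<in> \<alpha> then c i j else 0) + (if j \<notin> \<alpha> then conjugate (c j i) else 0)"
      using form unfolding sum.distrib delta[OF ij(1)] delta[OF ij(2)] by metis
    then have "(i \<in> \<alpha> \<longleftrightarrow> j \<in> \<alpha>) \<Longrightarrow> conjugate (c j i) = c i j"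
      and "\<not> (i \<in> \<alpha> \<longleftrightarrow> j \<in> \<alpha>) \<Longrightarrow> conjugate (c j i) = - c i j"
      by (auto simp: add_eq_0_iff)
    then show "c j i = (if i \<in> \<alpha> \<longleftrightarrow> j \<in> \<alpha> then conjugate (c i j) else - conjugate (c i j))"
      by (metis conjugate_id conjugate_neg)
  qed
qed

section \<open>Signs of principal minors of Hermitian matrices\<close>
lemma hermitian_principal_minor_real:
  assumes "finite X" "\<And>i j. i \<in> X \<Longrightarrow> j \<in> X \<Longrightarrow> f j i = cnj (f i j)"
  shows "Im (principal_minor f X) = 0"
proof -
  have "cnj (principal_minor f X) = principal_minor (\<lambda>i j. cnj (f i j)) X"
    by (rule principal_minor_hom[symmetric]) simp_all
  also have "\<dots> = principal_minor (\<lambda>i j. f j i) X"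
    by (rule principal_minor_cong) (rule assms(2)[symmetric])
  also have "\<dots> = principal_minor f X"
    using assms(1) by (rule principal_minor_transpose)
  finally show ?thesis by (simp add: complex_eq_iff)
qed

lemma hermitian_pivot_transform:
  assumes herm: "\<forall>i<n. \<forall>j<n. f j i = cnj (f i j)"
    and \<alpha>: "\<alpha> \<subseteq> {..<n}" and nz: "Re (principal_minor f \<alpha>) \<noteq> 0"
  shows "\<exists>c. (\<forall>X \<subseteq> {..<n}. Re (principal_minor f (sym_diff \<alpha> X))
        = Re (principal_minor f \<alpha>) * Re (principal_minor c X)) \<and>
    (\<forall>i < n. \<forall>j < n. c j i = (if i \<in> \<alpha> \<longleftrightarrow> j \<in> \<alpha> then cnj (c i j) else - cnj (c i j)))"
proof -
  have herm': "\<forall>i<n. \<forall>j<n. f j i = conjugate (f i j)"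
    unfolding conjugate_complex_def by (rule herm)
  have nz': "principal_minor f \<alpha> \<noteq> 0" using nz by auto
  obtain c where c: "\<forall>X \<subseteq> {..<n}.
       principal_minor f (sym_diff \<alpha> X) = principal_minor f \<alpha> * principal_minor c X"
    "\<forall>i < n. \<forall>j < n. c j i = (if i \<in> \<alpha> \<longleftrightarrow> j \<in> \<alpha> then cnj (c i j) else - cnj (c i j))"
    using principal_pivot_transform[OF herm' \<alpha> nz'] unfolding conjugate_complex_def
    by (elim exE conjE)
  have "Im (principal_minor f \<alpha>) = 0"
    using \<alpha> herm
    by (intro hermitian_principal_minor_real finite_subset[OF \<alpha>] finite_lessThan) blast
  then have "\<forall>X \<subseteq> {..<n}. Re (principal_minor f (sym_diff \<alpha> X))
      = Re (principal_minor f \<alpha>) * Re (principal_minor c X)"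
    using c(1) by simp
  with c(2) show ?thesis by (intro exI[of _ c] conjI)
qed

text \<open>
  Pivot at \<open>\<gamma>\<close>, that is, pass to the inverse \<open>c\<close>. Its diagonal entry at \<open>i\<close> is zero, but row \<open>i\<close> is not,
  and a nonzero entry \<open>c i j\<close> yields the negative minor \<open>- |c i j|\<^sup>2\<close> on \<open>{i, j}\<close>. In particular, if all minors of
  two consecutive orders vanish, then so do those of the next order.
\<close>
lemma opposite_sign_two_below:
  assumes herm: "\<forall>i<n. \<forall>j<n. f j i = cnj (f i j)"
    and \<gamma>: "\<gamma> \<subseteq> {..<n}" and nz: "Re (principal_minor f \<gamma>) \<noteq> 0"
    and i: "i \<in> \<gamma>" and zero: "Re (principal_minor f (\<gamma> - {i})) = 0"
  obtains j where "j \<in> \<gamma> - {i}"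
    "Re (principal_minor f \<gamma>) * Re (principal_minor f (\<gamma> - {i, j})) < 0"
proof -
  have "\<exists>c. (\<forall>X \<subseteq> {..<n}. Re (principal_minor f (sym_diff \<gamma> X))
        = Re (principal_minor f \<gamma>) * Re (principal_minor c X)) \<and>
    (\<forall>i < n. \<forall>j < n. c j i = (if i \<in> \<gamma> \<longleftrightarrow> j \<in> \<gamma> then cnj (c i j) else - cnj (c i j)))"
    by (rule hermitian_pivot_transform[OF herm \<gamma> nz])
  then obtain c where c: "\<forall>X \<subseteq> {..<n}. Re (principal_minor f (sym_diff \<gamma> X))
        = Re (principal_minor f \<gamma>) * Re (principal_minor c X)"
    "\<forall>i < n. \<forall>j < n. c j i = (if i \<in> \<gamma> \<longleftrightarrow> j \<in> \<gamma> then cnj (c i j) else - cnj (c i j))"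
    by (elim exE conjE)
  note minor = c(1)[rule_format] and sym = c(2)[rule_format]
  have lt: "l < n" if "l \<in> \<gamma>" for l using \<gamma> that by auto
  have "sym_diff \<gamma> {i} = \<gamma> - {i}" using i by auto
  then have "Re (c i i) = 0"
    using minor[of "{i}"] zero nz lt[OF i] by simp
  moreover have "Im (c i i) = 0"
    using sym[of i i] lt[OF i] by (simp add: complex_eq_iff)
  ultimately have cii: "c i i = 0" by (simp add: complex_eq_iff)
  have "principal_minor c \<gamma> \<noteq> 0"
    using minor[OF \<gamma>] by auto
  then obtain j where j: "j \<in> \<gamma>" "c i j \<noteq> 0"
    using principal_minor_zero_row[of \<gamma> i c] i finite_subset[OF \<gamma>] by blast
  then have ij: "i \<noteq> j" using cii by auto
  have "sym_diff \<gamma> {i, j} = \<gamma> - {i, j}" using i j by auto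
  moreover have "c i j * c j i = of_real ((cmod (c i j))\<^sup>2)"
    using sym[of i j] lt i j by (simp add: complex_mult_cnj cmod_def)
  ultimately have "Re (principal_minor f (\<gamma> - {i, j})) = - Re (principal_minor f \<gamma>) * (cmod (c i j))\<^sup>2"
    using minor[of "{i, j}"] lt i j ij cii by (simp add: principal_minor_2)
  then have "Re (principal_minor f \<gamma>) * Re (principal_minor f (\<gamma> - {i, j}))
      = - ((Re (principal_minor f \<gamma>))\<^sup>2 * (cmod (c i j))\<^sup>2)"
    by (simp add: power2_eq_square)
  also have "\<dots> < 0" using nz j by simp
  finally show ?thesis using that[of j] j ij by blast
qed

text \<open>
  Suppose the conclusion fails and move \<open>\<alpha>\<close> towards \<open>\<beta>\<close> as far as possible while keeping its sign.
  Pivot at \<open>\<alpha>\<close>. For \<open>i \<in> \<alpha> - \<beta>\<close> and \<open>j \<in> \<beta> - \<alpha>\<close> the minor of \<open>c\<close> on \<open>{i, j}\<close> is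
  \<open>c i i * c j j + |c i j|\<^sup>2\<close>, whose first summand is nonnegative by assumption; it cannot be
  positive, since exchanging \<open>i\<close> for \<open>j\<close> would bring \<open>\<alpha>\<close> closer to \<open>\<beta>\<close>. Hence \<open>c\<close> splits into two blocks
  on \<open>\<alpha> - \<beta>\<close> and \<open>\<beta> - \<alpha>\<close>, both nonsingular because \<open>\<beta>\<close> has a nonzero minor, and at most one of
  them has a nonzero diagonal entry. A nonzero diagonal entry in one block and a nonzero
  off-diagonal entry in the other give minors of orders \<open>k - 1\<close> and \<open>k + 1\<close> of opposite signs. If both diagonals
  vanish, a double exchange has a positive minor and again brings \<open>\<alpha>\<close> closer to \<open>\<beta>\<close>.
\<close>
lemma opposite_signs_in_neighbouring_orders:
  assumes herm: "\<forall>i<n. \<forall>j<n. f j i = cnj (f i j)"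
    and \<alpha>: "\<alpha> \<subseteq> {..<n}" "card \<alpha> = k" and \<beta>: "\<beta> \<subseteq> {..<n}" "card \<beta> = k"
    and opp: "Re (principal_minor f \<alpha>) * Re (principal_minor f \<beta>) < 0"
  shows "\<exists>A B. A \<subseteq> {..<n} \<and> Suc (card A) = k \<and> B \<subseteq> {..<n} \<and> card B = Suc k \<and>
    Re (principal_minor f A) * Re (principal_minor f B) < 0"
  using \<alpha> opp
proof (induction "card (\<alpha> - \<beta>)" arbitrary: \<alpha> rule: less_induct)
  case less
  note \<alpha> = less.prems(1,2) and opp = less.prems(3)
  define g where "g X = Re (principal_minor f X)" for X
  have fin: "finite \<alpha>" "finite \<beta>" using \<alpha>(1) \<beta>(1) finite_subset by blast+
  have g\<alpha>: "g \<alpha> \<noteq> 0" using opp by (auto simp: g_def)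
  have "\<exists>c. (\<forall>X \<subseteq> {..<n}. g (sym_diff \<alpha> X) = g \<alpha> * Re (principal_minor c X)) \<and>
    (\<forall>i < n. \<forall>j < n. c j i = (if i \<in> \<alpha> \<longleftrightarrow> j \<in> \<alpha> then cnj (c i j) else - cnj (c i j)))"
    unfolding g_def by (rule hermitian_pivot_transform[OF herm \<alpha>(1)]) (use g\<alpha> in \<open>simp_all add: g_def\<close>)
  then obtain c where c: "\<forall>X \<subseteq> {..<n}. g (sym_diff \<alpha> X) = g \<alpha> * Re (principal_minor c X)"
    "\<forall>i < n. \<forall>j < n. c j i = (if i \<in> \<alpha> \<longleftrightarrow> j \<in> \<alpha> then cnj (c i j) else - cnj (c i j))"
    by (elim exE conjE)
  note minor = c(1)[rule_format] and sym = c(2)[rule_format]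
  show ?case
  proof (rule ccontr)
    assume "\<not> ?case"
    then have level: "g A * g B \<ge> 0"
      if "A \<subseteq> {..<n}" "Suc (card A) = k" "B \<subseteq> {..<n}" "card B = Suc k" for A B
      using that unfolding g_def not_less[symmetric] by blast
    have closer: "Re (principal_minor c X) \<le> 0"
      if "X \<subseteq> {..<n}" "card (sym_diff \<alpha> X) = k" "card (sym_diff \<alpha> X - \<beta>) < card (\<alpha> - \<beta>)" for X
    proof (rule ccontr)
      assume "\<not> ?thesis"
      then have "Re (principal_minor c X) * (g \<alpha> * g \<beta>) < 0"
        using opp by - (rule mult_pos_neg, simp_all add: g_def)
      moreover have "g (sym_diff \<alpha> X) * g \<beta> = Re (principal_minor c X) * (g \<alpha> * g \<beta>)"
        using minor[OF that(1)] by simp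
      ultimately have "g (sym_diff \<alpha> X) * g \<beta> < 0" by (simp only:)
      moreover have "sym_diff \<alpha> X \<subseteq> {..<n}" using \<alpha>(1) that(1) by blast
      ultimately show False
        using less.hyps[OF that(3) _ that(2)] \<open>\<not> ?case\<close> unfolding g_def by blast
    qed
    define A where "A = \<alpha> - \<beta>"
    define D where "D = \<beta> - \<alpha>"
    have AD: "finite A" "finite D" "A \<inter> D = {}" "A \<subseteq> {..<n}" "D \<subseteq> {..<n}"
      using fin \<alpha>(1) \<beta>(1) by (auto simp: A_def D_def)
    have cardAD: "card A = card D"
      using card_le_sym_Diff[of \<alpha> \<beta>] card_le_sym_Diff[of \<beta> \<alpha>] \<alpha>(2) \<beta>(2) fin
      by (simp add: A_def D_def)
    have A: "i \<in> \<alpha>" "i \<notin> \<beta>" "i < n" if "i \<in> A" for i using that \<alpha> by (auto simp: A_def)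
    have D: "i \<notin> \<alpha>" "i \<in> \<beta>" "i < n" if "i \<in> D" for i using that \<beta> by (auto simp: D_def)
    have real: "c i i = of_real (Re (c i i))" if "i < n" for i
      using sym[of i i] that by (simp add: complex_eq_iff)
    have cardA: "card (\<alpha> - {i}) = k - 1" "Suc (k - 1) = k" if "i \<in> A" for i
      using A[OF that] \<alpha>(2) fin card_gt_0_iff[of \<alpha>] by auto
    have cross: "c i j = 0 \<and> c i i * c j j = 0" if i: "i \<in> A" and j: "j \<in> D" for i j
    proof -
      have ij: "i \<noteq> j" using A[OF i] D[OF j] by auto
      have "sym_diff \<alpha> {i} = \<alpha> - {i}" "sym_diff \<alpha> {j} = insert j \<alpha>"
        using A[OF i] D[OF j] by auto
      then have "g (\<alpha> - {i}) = g \<alpha> * Re (c i i)" "g (insert j \<alpha>) = g \<alpha> * Re (c j j)"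
        using minor[of "{i}"] minor[of "{j}"] A[OF i] D[OF j] by simp_all
      moreover have "g (\<alpha> - {i}) * g (insert j \<alpha>) \<ge> 0"
        by (rule level) (use \<alpha> D[OF j] fin cardA[OF i] in auto)
      ultimately have "0 \<le> (g \<alpha>)\<^sup>2 * (Re (c i i) * Re (c j j))"
        by (simp add: power2_eq_square algebra_simps)
      then have nonneg: "0 \<le> Re (c i i) * Re (c j j)"
        using g\<alpha> by (simp add: zero_le_mult_iff)
      have X: "sym_diff \<alpha> {i, j} = insert j (\<alpha> - {i})" using A[OF i] D[OF j] by auto
      have "insert j (\<alpha> - {i}) - \<beta> \<subset> \<alpha> - \<beta>"
        using A[OF i] D[OF j] by auto
      then have "card (sym_diff \<alpha> {i, j} - \<beta>) < card (\<alpha> - \<beta>)"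
        unfolding X by (rule psubset_card_mono[rotated]) (simp add: fin)
      moreover have "card (sym_diff \<alpha> {i, j}) = k"
        unfolding X using cardA[OF i] D[OF j] fin by simp
      moreover have "{i, j} \<subseteq> {..<n}" using A[OF i] D[OF j] by simp
      ultimately have "Re (principal_minor c {i, j}) \<le> 0"
        by (intro closer)
      moreover have "c i j * c j i = - of_real ((cmod (c i j))\<^sup>2)"
        using sym[of i j] A[OF i] D[OF j] by (simp add: complex_mult_cnj cmod_def)
      ultimately have "Re (c i i * c j j) + (cmod (c i j))\<^sup>2 \<le> 0"
        using ij by (simp add: principal_minor_2)
      moreover have "c i i * c j j = of_real (Re (c i i) * Re (c j j))"
        using real[of i] real[of j] A[OF i] D[OF j] by (metis of_real_mult)
      ultimately show ?thesis using nonneg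
        by (smt (verit) Re_complex_of_real norm_eq_zero of_real_0 power2_less_eq_zero_iff zero_le_power2)
    qed
    have block: "principal_minor c (X \<union> Y) = principal_minor c X * principal_minor c Y"
      if "X \<subseteq> A" "Y \<subseteq> D" for X Y
    proof (rule principal_minor_block)
      show "finite X" "finite Y" using that AD finite_subset by blast+
      show "X \<inter> Y = {}" using that AD by blast
      show "c i j = 0" if "i \<in> X" "j \<in> Y" for i j
        using cross \<open>X \<subseteq> A\<close> \<open>Y \<subseteq> D\<close> that by blast
    qed
    have "sym_diff \<alpha> (A \<union> D) = \<beta>" by (auto simp: A_def D_def)
    then have "principal_minor c (A \<union> D) \<noteq> 0"
      using minor[of "A \<union> D"] AD opp unfolding g_def[symmetric] by auto
    then have nzAD: "principal_minor c A \<noteq> 0" "principal_minor c D \<noteq> 0"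
      using block[of A D] by auto
    have rowA: "\<exists>i'\<in>A. c i i' \<noteq> 0" if "i \<in> A" for i
      using principal_minor_zero_row[of A i c] nzAD(1) that AD by blast
    have rowD: "\<exists>j'\<in>D. c j j' \<noteq> 0" if "j \<in> D" for j
      using principal_minor_zero_row[of D j c] nzAD(2) that AD by blast
    have "A \<noteq> {}"
    proof
      assume "A = {}"
      then have "D = {}" using cardAD AD by simp
      with \<open>A = {}\<close> have "\<alpha> = \<beta>" by (auto simp: A_def D_def)
      then show False using opp by (simp add: not_square_less_zero)
    qed
    then obtain i j where i: "i \<in> A" and j: "j \<in> D"
      using cardAD AD by fastforce
    have off: "principal_minor c {l, l'} = - of_real ((cmod (c l l'))\<^sup>2)"
      if "c l l = 0" "l \<noteq> l'" "l < n" "l' < n" "l \<in> \<alpha> \<longleftrightarrow> l' \<in> \<alpha>" for l l'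
      using that sym[of l l'] by (simp add: principal_minor_2 complex_mult_cnj cmod_def)
    have card2: "card (\<alpha> - {i, i'}) = k - 2" "2 \<le> k" if "i \<in> A" "i' \<in> A" "i \<noteq> i'" for i i'
    proof -
      have "{i, i'} \<subseteq> \<alpha>" using A(1) that by auto
      then show "card (\<alpha> - {i, i'}) = k - 2" "2 \<le> k"
        using card_Diff_subset[of "{i, i'}" \<alpha>] card_mono[OF fin(1), of "{i, i'}"] that \<alpha>(2) by auto
    qed
    consider (D) j where "j \<in> D" "c j j \<noteq> 0" | (A) i where "i \<in> A" "c i i \<noteq> 0"
      | (N) "\<forall>i\<in>A. c i i = 0" "\<forall>j\<in>D. c j j = 0" by blast
    then show False
    proof cases
      case j: D
      have cii: "c i i = 0" using cross[OF i j(1)] j(2) by auto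
      then obtain i' where i': "i' \<in> A" "c i i' \<noteq> 0" "i \<noteq> i'" using rowA[OF i] by auto
      have "sym_diff \<alpha> {j} = insert j \<alpha>" "sym_diff \<alpha> ({i, i'} \<union> {j}) = insert j (\<alpha> - {i, i'})"
        using D[OF j(1)] A[OF i] A[OF i'(1)] by auto
      then have "g (insert j \<alpha>) = g \<alpha> * Re (c j j)"
        and "g (insert j (\<alpha> - {i, i'})) = g \<alpha> * Re (principal_minor c {i, i'} * c j j)"
        using minor[of "{j}"] minor[of "{i, i'} \<union> {j}"] block[of "{i, i'}" "{j}"]
          D[OF j(1)] A[OF i] A[OF i'(1)] i i' j by simp_all
      moreover have "principal_minor c {i, i'} = - of_real ((cmod (c i i'))\<^sup>2)"
        using cii i' A[OF i] A[OF i'(1)] by (intro off) auto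
      ultimately have "g (insert j (\<alpha> - {i, i'})) * g (insert j \<alpha>) = - ((g \<alpha> * cmod (c i i') * Re (c j j))\<^sup>2)"
        by (simp add: power2_eq_square algebra_simps)
      moreover have "Re (c j j) \<noteq> 0" using real[of j] D[OF j(1)] j(2) by auto
      ultimately have "g (insert j (\<alpha> - {i, i'})) * g (insert j \<alpha>) < 0"
        using g\<alpha> i' by simp
      moreover have "g (insert j (\<alpha> - {i, i'})) * g (insert j \<alpha>) \<ge> 0"
        by (rule level) (use card2[OF i i'(1,3)] D[OF j(1)] \<alpha> fin in auto)
      ultimately show False by simp
    next
      case i: A
      have cjj: "c j j = 0" using cross[OF i(1) j] i(2) by auto
      then obtain j' where j': "j' \<in> D" "c j j' \<noteq> 0" "j \<noteq> j'" using rowD[OF j] by auto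
      have "sym_diff \<alpha> {i} = \<alpha> - {i}" "sym_diff \<alpha> ({i} \<union> {j, j'}) = insert j (insert j' (\<alpha> - {i}))"
        using A[OF i(1)] D[OF j] D[OF j'(1)] by auto
      then have "g (\<alpha> - {i}) = g \<alpha> * Re (c i i)"
        and "g (insert j (insert j' (\<alpha> - {i}))) = g \<alpha> * Re (c i i * principal_minor c {j, j'})"
        using minor[of "{i}"] minor[of "{i} \<union> {j, j'}"] block[of "{i}" "{j, j'}"]
          A[OF i(1)] D[OF j] D[OF j'(1)] i j j' by simp_all
      moreover have "principal_minor c {j, j'} = - of_real ((cmod (c j j'))\<^sup>2)"
        using cjj j' D[OF j] D[OF j'(1)] by (intro off) auto
      ultimately have "g (\<alpha> - {i}) * g (insert j (insert j' (\<alpha> - {i}))) = - ((g \<alpha> * cmod (c j j') * Re (c i i))\<^sup>2)"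
        by (simp add: power2_eq_square algebra_simps)
      moreover have "Re (c i i) \<noteq> 0" using real[of i] A[OF i(1)] i(2) by auto
      ultimately have "g (\<alpha> - {i}) * g (insert j (insert j' (\<alpha> - {i}))) < 0"
        using g\<alpha> j' by simp
      moreover have "g (\<alpha> - {i}) * g (insert j (insert j' (\<alpha> - {i}))) \<ge> 0"
        by (rule level) (use cardA[OF i(1)] D[OF j] D[OF j'(1)] j'(3) \<alpha> fin in auto)
      ultimately show False by simp
    next
      case N
      obtain i' where i': "i' \<in> A" "c i i' \<noteq> 0" "i \<noteq> i'" using rowA[OF i] N(1) i by fastforce
      obtain j' where j': "j' \<in> D" "c j j' \<noteq> 0" "j \<noteq> j'" using rowD[OF j] N(2) j by fastforce
      let ?X = "{i, i'} \<union> {j, j'}"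
      have X: "sym_diff \<alpha> ?X = insert j (insert j' (\<alpha> - {i, i'}))"
        using A[OF i] A[OF i'(1)] D[OF j] D[OF j'(1)] by auto
      have "insert j (insert j' (\<alpha> - {i, i'})) - \<beta> = (\<alpha> - \<beta>) - {i, i'}"
        using D[OF j] D[OF j'(1)] by auto
      moreover have "(\<alpha> - \<beta>) - {i, i'} \<subset> \<alpha> - \<beta>"
        using i by (auto simp: A_def)
      ultimately have "card (sym_diff \<alpha> ?X - \<beta>) < card (\<alpha> - \<beta>)"
        unfolding X using fin psubset_card_mono[of "\<alpha> - \<beta>"] by simp
      moreover have "card (sym_diff \<alpha> ?X) = k"
        unfolding X using card2[OF i i'(1,3)] D[OF j] D[OF j'(1)] j'(3) fin by simp
      moreover have "?X \<subseteq> {..<n}" using A[OF i] A[OF i'(1)] D[OF j] D[OF j'(1)] by auto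
      ultimately have "Re (principal_minor c ?X) \<le> 0" by (intro closer)
      moreover have "principal_minor c {i, i'} = - of_real ((cmod (c i i'))\<^sup>2)"
        using N(1) i i' A[OF i] A[OF i'(1)] by (intro off) auto
      moreover have "principal_minor c {j, j'} = - of_real ((cmod (c j j'))\<^sup>2)"
        using N(2) j j' D[OF j] D[OF j'(1)] by (intro off) auto
      moreover have "principal_minor c ?X = principal_minor c {i, i'} * principal_minor c {j, j'}"
        using i i' j j' by (intro block) auto
      ultimately have "(cmod (c i i'))\<^sup>2 * (cmod (c j j'))\<^sup>2 \<le> 0"
        by (simp flip: of_real_power of_real_mult)
      moreover have "(cmod (c i i'))\<^sup>2 * (cmod (c j j'))\<^sup>2 > 0" using i' j' by simp
      ultimately show False by simp
    qed
  qed
qed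

section \<open>Two restrictions on real symmetric matrices\<close>
lemma real_symmetric_pivot_transform:
  fixes f :: "nat \<Rightarrow> nat \<Rightarrow> real"
  assumes sym: "\<forall>i<n. \<forall>j<n. f j i = f i j"
    and \<alpha>: "\<alpha> \<subseteq> {..<n}" and nz: "principal_minor f \<alpha> \<noteq> 0"
  shows "\<exists>c. (\<forall>X \<subseteq> {..<n}.
       principal_minor f (sym_diff \<alpha> X) = principal_minor f \<alpha> * principal_minor c X) \<and>
    (\<forall>i < n. \<forall>j < n. c j i = (if i \<in> \<alpha> \<longleftrightarrow> j \<in> \<alpha> then c i j else - c i j))"
proof -
  have sym': "\<forall>i<n. \<forall>j<n. f j i = conjugate (f i j)"
    unfolding conjugate_real_def by (rule sym)
  show ?thesis
    using principal_pivot_transform[OF sym' \<alpha> nz] unfolding conjugate_real_def .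
qed

lemma of_real_principal_minor:
  "principal_minor (\<lambda>i j. complex_of_real (f i j)) X = of_real (principal_minor f X)"
  by (rule principal_minor_hom) simp_all

lemma real_nonzero_two_below:
  fixes f :: "nat \<Rightarrow> nat \<Rightarrow> real"
  assumes sym: "\<forall>i<n. \<forall>j<n. f j i = f i j"
    and \<gamma>: "\<gamma> \<subseteq> {..<n}" and nz: "principal_minor f \<gamma> \<noteq> 0"
    and i: "i \<in> \<gamma>" and zero: "principal_minor f (\<gamma> - {i}) = 0"
  obtains j where "j \<in> \<gamma> - {i}" "principal_minor f (\<gamma> - {i, j}) \<noteq> 0"
proof -
  have herm: "\<forall>i<n. \<forall>j<n. complex_of_real (f j i) = cnj (complex_of_real (f i j))"
    unfolding complex_cnj_complex_of_real using sym by metis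
  have "Re (principal_minor (\<lambda>i j. complex_of_real (f i j)) \<gamma>) \<noteq> 0"
    "Re (principal_minor (\<lambda>i j. complex_of_real (f i j)) (\<gamma> - {i})) = 0"
    using nz zero by (simp_all add: of_real_principal_minor)
  from opposite_sign_two_below[OF herm \<gamma> this(1) i this(2)]
  obtain j where "j \<in> \<gamma> - {i}"
    "principal_minor f \<gamma> * principal_minor f (\<gamma> - {i, j}) < 0"
    unfolding of_real_principal_minor Re_complex_of_real .
  then show thesis by (intro that[of j]) auto
qed

text \<open>
  Inside \<open>\<gamma>\<close> there is a set \<open>\<zeta>\<close> of \<open>k - 1\<close> indices with nonzero minor. The pivot at \<open>\<zeta>\<close>, restricted to the
  other three indices, is a Schur complement with zero diagonal (order \<open>k\<close>) and nonzero off-diagonal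
  entries (order \<open>k + 1\<close>), so its determinant \<open>2 * c x y * c y z * c x z\<close> is nonzero. For
  a Hermitian matrix this would be twice the real part of a product, which may vanish.
\<close>
lemma real_symmetric_nonzero_after_N_A:
  fixes f :: "nat \<Rightarrow> nat \<Rightarrow> real"
  assumes sym: "\<forall>i<n. \<forall>j<n. f j i = f i j"
    and zero: "\<And>X. X \<subseteq> {..<n} \<Longrightarrow> card X = k \<Longrightarrow> principal_minor f X = 0"
    and nz: "\<And>X. X \<subseteq> {..<n} \<Longrightarrow> card X = Suc k \<Longrightarrow> principal_minor f X \<noteq> 0"
    and \<gamma>: "\<gamma> \<subseteq> {..<n}" "card \<gamma> = Suc (Suc k)"
  shows "principal_minor f \<gamma> \<noteq> 0"
proof -
  have fin: "finite \<gamma>" using \<gamma>(1) finite_subset by blast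
  have k: "k \<noteq> 0" using zero[of "{}"] by auto
  obtain x where x: "x \<in> \<gamma>" using \<gamma>(2) by fastforce
  have cx: "card (\<gamma> - {x}) = Suc k" using x \<gamma>(2) fin by simp
  then obtain y where y: "y \<in> \<gamma>" "y \<noteq> x" by (metis Diff_iff card.empty ex_in_conv insertI1 nat.distinct(1))
  have sub: "\<gamma> - S \<subseteq> {..<n}" for S using \<gamma>(1) by blast
  have "\<gamma> - {x} - {y} = \<gamma> - {x, y}" by auto
  moreover have cxy: "card (\<gamma> - {x, y}) = k" using x y \<gamma>(2) fin by (simp add: card_Diff_subset)
  ultimately have "principal_minor f (\<gamma> - {x} - {y}) = 0" using zero sub by metis
  then obtain z where z: "z \<in> \<gamma> - {x} - {y}" "principal_minor f (\<gamma> - {x} - {y, z}) \<noteq> 0"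
    using real_nonzero_two_below[OF sym sub nz[OF sub cx], of y] y by auto
  define \<zeta> where "\<zeta> = \<gamma> - {x, y, z}"
  have "\<gamma> - {x} - {y, z} = \<zeta>" unfolding \<zeta>_def by auto
  then have nz\<zeta>: "principal_minor f \<zeta> \<noteq> 0" using z(2) by simp
  have \<zeta>: "\<zeta> \<subseteq> {..<n}" unfolding \<zeta>_def by (rule sub)
  obtain c where c: "\<forall>X \<subseteq> {..<n}.
       principal_minor f (sym_diff \<zeta> X) = principal_minor f \<zeta> * principal_minor c X"
    "\<forall>i < n. \<forall>j < n. c j i = (if i \<in> \<zeta> \<longleftrightarrow> j \<in> \<zeta> then c i j else - c i j)"
    using real_symmetric_pivot_transform[OF sym \<zeta> nz\<zeta>] by (elim exE conjE)
  have lt: "x < n" "y < n" "z < n" and ne: "x \<noteq> y" "x \<noteq> z" "y \<noteq> z"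
    using \<gamma>(1) x y z by auto
  have diag: "c u u = 0" if "{u, v, w} = {x, y, z}" "u \<noteq> v" "u \<noteq> w" "v \<noteq> w" for u v w
  proof -
    have "u \<in> {x, y, z}" "v \<in> {x, y, z}" "w \<in> {x, y, z}" using that(1) by auto
    then have uvw: "u \<in> \<gamma>" "v \<in> \<gamma>" "w \<in> \<gamma>" "u < n" using x y z lt by auto
    have "sym_diff \<zeta> {u} = \<gamma> - {v, w}" unfolding \<zeta>_def that(1)[symmetric] using uvw that by auto
    moreover have "card (\<gamma> - {v, w}) = k" using uvw that \<gamma>(2) fin by (simp add: card_Diff_subset)
    ultimately have "principal_minor f \<zeta> * c u u = 0"
      using c(1)[rule_format, of "{u}"] zero[OF sub] uvw by simp
    then show ?thesis using nz\<zeta> by simp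
  qed
  have off: "c v w \<noteq> 0" if "{u, v, w} = {x, y, z}" "u \<noteq> v" "u \<noteq> w" "v \<noteq> w" for u v w
  proof -
    have "u \<in> {x, y, z}" "v \<in> {x, y, z}" "w \<in> {x, y, z}" using that(1) by auto
    then have uvw: "u \<in> \<gamma>" "v \<in> \<gamma>" "w \<in> \<gamma>" "v < n" "w < n" using x y z lt by auto
    have "sym_diff \<zeta> {v, w} = \<gamma> - {u}" unfolding \<zeta>_def that(1)[symmetric] using uvw that by auto
    moreover have "card (\<gamma> - {u}) = Suc k" using uvw that \<gamma>(2) fin by simp
    ultimately have "principal_minor c {v, w} \<noteq> 0"
      using c(1)[rule_format, of "{v, w}"] nz[OF sub] uvw by auto
    moreover have "{v, u, w} = {x, y, z}" using that(1) by auto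
    then have "c v v = 0" using diag[of v u w] that by auto
    ultimately show ?thesis using that(4) by (auto simp: principal_minor_2)
  qed
  have sw: "c y x = c x y" "c z x = c x z" "c z y = c y z"
    using c(2)[rule_format, of x y] c(2)[rule_format, of x z] c(2)[rule_format, of y z] lt
    by (simp_all add: \<zeta>_def)
  have "principal_minor c {x, y, z} = 2 * c x y * c y z * c x z"
    using ne diag[of x y z] diag[of y x z] diag[of z x y]
    by (simp add: principal_minor_3 sw insert_commute)
  moreover have "c x y \<noteq> 0" "c y z \<noteq> 0" "c x z \<noteq> 0"
    using off[of z x y] off[of x y z] off[of y x z] ne by (auto simp: insert_commute)
  moreover have "sym_diff \<zeta> {x, y, z} = \<gamma>" unfolding \<zeta>_def using x y z by auto
  ultimately show ?thesis
    using c(1)[rule_format, of "{x, y, z}"] lt nz\<zeta> by auto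
qed

text \<open>
  The inverse \<open>b\<close> of the submatrix has zero diagonal, so its minors of order 3 are twice products of
  three entries. Each of the six off-diagonal entries occurs in two of these four products, which
  makes the product of the four diagonal entries of \<open>c\<close> a square.
\<close>
lemma real_symmetric_quad_diagonal:
  fixes c :: "nat \<Rightarrow> nat \<Rightarrow> real"
  assumes sym: "\<forall>i<n. \<forall>j<n. c j i = c i j"
    and lt: "x < n" "y < n" "z < n" "w < n"
    and ne: "x \<noteq> y" "x \<noteq> z" "x \<noteq> w" "y \<noteq> z" "y \<noteq> w" "z \<noteq> w"
    and zero: "principal_minor c {x, y, z} = 0" "principal_minor c {x, y, w} = 0"
      "principal_minor c {x, z, w} = 0" "principal_minor c {y, z, w} = 0"
    and nz: "principal_minor c {x, y, z, w} \<noteq> 0"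
    and diag: "c x x \<noteq> 0" "c y y \<noteq> 0" "c z z \<noteq> 0" "c w w \<noteq> 0"
  shows "c x x * c y y * c z z * c w w > 0"
proof -
  let ?Q = "{x, y, z, w}"
  have Q: "?Q \<subseteq> {..<n}" using lt by simp
  define P where "P = principal_minor c ?Q"
  obtain b where b: "\<forall>X \<subseteq> {..<n}. principal_minor c (sym_diff ?Q X) = P * principal_minor b X"
    "\<forall>i < n. \<forall>j < n. b j i = (if i \<in> ?Q \<longleftrightarrow> j \<in> ?Q then b i j else - b i j)"
    using real_symmetric_pivot_transform[OF sym Q nz] unfolding P_def by (elim exE conjE)
  have P: "P \<noteq> 0" using nz by (simp add: P_def)
  have complement: "principal_minor c S = P * principal_minor b T"
    if "sym_diff ?Q T = S" "T \<subseteq> {..<n}" for S T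
    using b(1)[rule_format, OF that(2)] that(1) by simp
  have "principal_minor c {y, z, w} = P * principal_minor b {x}"
    "principal_minor c {x, z, w} = P * principal_minor b {y}"
    "principal_minor c {x, y, w} = P * principal_minor b {z}"
    "principal_minor c {x, y, z} = P * principal_minor b {w}"
    by (rule complement; use ne lt in auto)+
  then have b0: "b x x = 0" "b y y = 0" "b z z = 0" "b w w = 0"
    using zero P by simp_all
  have sw: "b y x = b x y" "b z x = b x z" "b w x = b x w" "b z y = b y z" "b w y = b y w" "b w z = b z w"
    using b(2)[rule_format, of x y] b(2)[rule_format, of x z] b(2)[rule_format, of x w]
      b(2)[rule_format, of y z] b(2)[rule_format, of y w] b(2)[rule_format, of z w] lt
    by simp_all
  have "principal_minor c {x} = P * principal_minor b {y, z, w}"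
    "principal_minor c {y} = P * principal_minor b {x, z, w}"
    "principal_minor c {z} = P * principal_minor b {x, y, w}"
    "principal_minor c {w} = P * principal_minor b {x, y, z}"
    by (rule complement; use ne lt in auto)+
  then have "c x x = P * (2 * b y z * b y w * b z w)" "c y y = P * (2 * b x z * b x w * b z w)"
    "c z z = P * (2 * b x y * b x w * b y w)" "c w w = P * (2 * b x y * b x z * b y z)"
    by (simp_all add: principal_minor_3 ne b0 sw)
  note eqs = this
  have "c x x * c y y * c z z * c w w
      = (2 * 2 * P * P * b x y * b x z * b x w * b y z * b y w * b z w)\<^sup>2"
    unfolding eqs power2_eq_square by (simp only: mult_ac)
  then have "c x x * c y y * c z z * c w w \<ge> 0" by (metis zero_le_power2)
  moreover have "c x x * c y y * c z z * c w w \<noteq> 0" using diag by simp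
  ultimately show ?thesis by linarith
qed

text \<open>
  The two sides of the equation agree up to sign, so only the parity of the number of negative
  factors matters.
\<close>
lemma triangle_product_sign:
  fixes u v w x y z :: real
  assumes "u\<^sup>2 = x * y" "v\<^sup>2 = y * z" "w\<^sup>2 = x * z" "x * y > 0" "y * z > 0"
  shows "u * v * w = x * y * z \<longleftrightarrow> (((u > 0) = (v > 0)) = ((w > 0) = (x > 0)))"
proof -
  have nz: "x \<noteq> 0" "y \<noteq> 0" "z \<noteq> 0" using assms by auto
  then have "u \<noteq> 0" "v \<noteq> 0" "w \<noteq> 0" using assms by auto
  have "(u * v * w)\<^sup>2 = (x * y * z)\<^sup>2"
    using assms(1-3) by (simp add: power_mult_distrib power2_eq_square algebra_simps)
  then have "u * v * w = x * y * z \<or> u * v * w = - (x * y * z)"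
    by (simp add: power2_eq_iff)
  moreover have "x * y * z > 0 \<longleftrightarrow> x > 0" "x * y * z \<noteq> 0"
    using assms(4,5) nz by (auto simp: zero_less_mult_iff mult_less_0_iff)
  ultimately have "u * v * w = x * y * z \<longleftrightarrow> (u * v * w > 0 \<longleftrightarrow> x > 0)"
    by auto
  also have "u * v * w > 0 \<longleftrightarrow> (((u > 0) = (v > 0)) = (w > 0))"
    using \<open>u \<noteq> 0\<close> \<open>v \<noteq> 0\<close> \<open>w \<noteq> 0\<close>
    by (auto simp: zero_less_mult_iff mult_less_0_iff not_less)
  finally show ?thesis by blast
qed

text \<open>
  The Schur complement \<open>s\<close> at \<open>p\<close> has zero minors of order 2 and a diagonal of constant sign. Hence
  its minor on three indices vanishes or not according to the signs of its three off-diagonal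
  entries. On four indices each off-diagonal entry lies in two triangles, so an even number of the
  four minors is nonzero.
\<close>
lemma real_symmetric_quads_parity:
  fixes c :: "nat \<Rightarrow> nat \<Rightarrow> real"
  assumes sym: "\<forall>i<n. \<forall>j<n. c j i = c i j"
    and lt: "p < n" "x < n" "y < n" "z < n" "w < n"
    and ne: "distinct [p, x, y, z, w]"
    and diag: "c p p \<noteq> 0"
    and two: "\<And>u. u \<in> {x, y, z, w} \<Longrightarrow> principal_minor c {p, u} < 0"
    and three: "\<And>u v. u \<in> {x, y, z, w} \<Longrightarrow> v \<in> {x, y, z, w} \<Longrightarrow> u \<noteq> v \<Longrightarrow>
      principal_minor c {p, u, v} = 0"
  shows "((principal_minor c {p, x, y, z} = 0) = (principal_minor c {p, x, y, w} = 0))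
    = ((principal_minor c {p, x, z, w} = 0) = (principal_minor c {p, y, z, w} = 0))"
proof -
  let ?R = "{x, y, z, w}"
  have p: "{p} \<subseteq> {..<n}" "principal_minor c {p} \<noteq> 0" using lt diag by simp_all
  obtain s where s: "\<forall>X \<subseteq> {..<n}. principal_minor c (sym_diff {p} X) = c p p * principal_minor s X"
    "\<forall>i < n. \<forall>j < n. s j i = (if i \<in> {p} \<longleftrightarrow> j \<in> {p} then s i j else - s i j)"
    using real_symmetric_pivot_transform[OF sym p] unfolding principal_minor_singleton
    by (elim exE conjE)
  have R: "u < n" "u \<noteq> p" if "u \<in> ?R" for u using that lt ne by auto
  have ins: "principal_minor c (insert p X) = c p p * principal_minor s X" if "X \<subseteq> ?R" for X
  proof -
    have "sym_diff {p} X = insert p X" "X \<subseteq> {..<n}" using that R by blast+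
    then show ?thesis using s(1) by metis
  qed
  have swap: "s v u = s u v" if "u \<in> ?R" "v \<in> ?R" for u v
    using s(2)[rule_format, of u v] R[OF that(1)] R[OF that(2)] by simp
  have neg: "c p p * s u u < 0" if "u \<in> ?R" for u
    using two[OF that] ins[of "{u}"] that by simp
  have same: "s u u * s v v > 0" if "u \<in> ?R" "v \<in> ?R" for u v
    using mult_neg_neg[OF neg[OF that(1)] neg[OF that(2)]] diag
    by (simp add: zero_less_mult_iff mult_less_0_iff) argo
  have sq: "(s u v)\<^sup>2 = s u u * s v v" if "u \<in> ?R" "v \<in> ?R" "u \<noteq> v" for u v
    using three[OF that] ins[of "{u, v}"] that diag swap[OF that(1,2)]
    by (simp add: principal_minor_2 power2_eq_square)
  have zero_iff: "principal_minor c {p, t, u, v} = 0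
      \<longleftrightarrow> (((s t u > 0) = (s u v > 0)) = ((s t v > 0) = (s x x > 0)))"
    if "t \<in> ?R" "u \<in> ?R" "v \<in> ?R" "t \<noteq> u" "t \<noteq> v" "u \<noteq> v" for t u v
  proof -
    have "principal_minor s {t, u, v} = 2 * (s t u * s u v * s t v) + s t t * s u u * s v v
        - s t t * (s u v)\<^sup>2 - s v v * (s t u)\<^sup>2 - s u u * (s t v)\<^sup>2"
      using that by (simp add: principal_minor_3 swap[of t u] swap[of t v] swap[of u v] power2_eq_square)
    also have "\<dots> = 2 * (s t u * s u v * s t v - s t t * s u u * s v v)"
      unfolding sq[OF that(1,2,4)] sq[OF that(1,3,5)] sq[OF that(2,3,6)] by simp
    finally have "principal_minor c {p, t, u, v} = 0 \<longleftrightarrow> s t u * s u v * s t v = s t t * s u u * s v v"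
      using ins[of "{t, u, v}"] that diag by simp
    also have "\<dots> \<longleftrightarrow> (((s t u > 0) = (s u v > 0)) = ((s t v > 0) = (s t t > 0)))"
      using that by (intro triangle_product_sign sq same) auto
    also have "s t t > 0 \<longleftrightarrow> s x x > 0"
      using same[of t x] that(1) by (auto simp: zero_less_mult_iff)
    finally show ?thesis .
  qed
  show ?thesis
    using zero_iff[of x y z] zero_iff[of x y w] zero_iff[of x z w] zero_iff[of y z w] ne by simp argo
qed

text \<open>
  Walking from \<open>\<alpha>\<close> to \<open>\<beta>\<close> by single exchanges, the property \<open>Q\<close> is lost in some step.
\<close>
lemma exchange_pair:
  assumes "finite \<alpha>" "finite \<beta>" "card \<alpha> = m" "card \<beta> = m" "Q \<alpha>" "\<not> Q \<beta>"
  shows "\<exists>\<gamma> a b. \<gamma> \<subseteq> \<alpha> \<union> \<beta> \<and> card \<gamma> = Suc m \<and> a \<in> \<gamma> \<and> b \<in> \<gamma> \<and> Q (\<gamma> - {a}) \<and> \<not> Q (\<gamma> - {b})"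
  using assms
proof (induction "card (\<alpha> - \<beta>)" arbitrary: \<alpha> rule: less_induct)
  case less
  have "\<not> \<alpha> \<subseteq> \<beta>"
    using card_subset_eq[of \<beta> \<alpha>] less.prems by metis
  then obtain i where i: "i \<in> \<alpha>" "i \<notin> \<beta>" by blast
  have "\<not> \<beta> \<subseteq> \<alpha>"
    using card_subset_eq[of \<alpha> \<beta>] less.prems by metis
  then obtain j where j: "j \<in> \<beta>" "j \<notin> \<alpha>" by blast
  define \<alpha>' where "\<alpha>' = insert j (\<alpha> - {i})"
  have card: "card \<alpha>' = m" "card (insert j \<alpha>) = Suc m"
    using i j less.prems card_gt_0_iff[of \<alpha>] unfolding \<alpha>'_def by auto
  show ?case
  proof (cases "Q \<alpha>'")
    case True
    have "\<alpha>' - \<beta> \<subset> \<alpha> - \<beta>" using i j by (auto simp: \<alpha>'_def)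
    then have "card (\<alpha>' - \<beta>) < card (\<alpha> - \<beta>)"
      using less.prems by (intro psubset_card_mono) auto
    moreover have "finite \<alpha>'" "\<alpha>' \<union> \<beta> \<subseteq> \<alpha> \<union> \<beta>" using less.prems j by (auto simp: \<alpha>'_def)
    ultimately show ?thesis using less.hyps[of \<alpha>'] less.prems card(1) True by (meson order_trans)
  next
    case False
    have "insert j \<alpha> - {j} = \<alpha>" "insert j \<alpha> - {i} = \<alpha>'" using i j by (auto simp: \<alpha>'_def)
    then show ?thesis
      using False less.prems card(2) i j
      by (intro exI[of _ "insert j \<alpha>"] exI[of _ j] exI[of _ i]) auto
  qed
qed

text \<open>
  A sign change among the minors of order \<open>k + 2\<close> happens between two sets that arise from some \<open>\<gamma>\<close>
  of \<open>k + 3\<close> indices by deleting \<open>a\<close> and \<open>b\<close>. Then \<open>\<gamma>\<close> is nonsingular, and its inverse \<open>c\<close> has diagonal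
  entries of opposite signs at \<open>a\<close> and \<open>b\<close>, negative minors of order 2 and zero minors of order 3.
  By \<open>real_nonzero_two_below\<close> some minor of order 4 on a set \<open>{a, b, i, j}\<close> is nonzero. Since \<open>k \<ge> 2\<close> there
  is a fifth index \<open>e\<close>. In a set of five indices, the parity lemma applied to every pivot makes either
  all five minors of order 4 zero or none. So the minors on \<open>{b, i, j, e}\<close> and \<open>{a, i, j, e}\<close> are nonzero too; by
  \<open>real_symmetric_quad_diagonal\<close> both products of diagonal entries are positive, and \<open>c\<close> has diagonal
  entries of the same sign at \<open>a\<close> and \<open>b\<close>, a contradiction.
\<close>
lemma real_symmetric_no_sign_change_after_N_A_plus:
  fixes f :: "nat \<Rightarrow> nat \<Rightarrow> real"
  assumes sym: "\<forall>i<n. \<forall>j<n. f j i = f i j"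
    and zero: "\<And>X. X \<subseteq> {..<n} \<Longrightarrow> card X = k \<Longrightarrow> principal_minor f X = 0"
    and pos: "\<And>X. X \<subseteq> {..<n} \<Longrightarrow> card X = Suc k \<Longrightarrow> principal_minor f X > 0"
    and nz: "\<And>X. X \<subseteq> {..<n} \<Longrightarrow> card X = Suc (Suc k) \<Longrightarrow> principal_minor f X \<noteq> 0"
    and \<alpha>: "\<alpha> \<subseteq> {..<n}" "card \<alpha> = Suc (Suc k)" "principal_minor f \<alpha> > 0"
    and \<beta>: "\<beta> \<subseteq> {..<n}" "card \<beta> = Suc (Suc k)" "principal_minor f \<beta> < 0"
  shows False
proof -
  have fin: "finite X" if "X \<subseteq> {..<n}" for X using that finite_subset by blast
  have k0: "k \<noteq> 0" using zero[of "{}"] by auto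
  have k1: "k \<noteq> 1"
  proof
    assume k: "k = 1"
    obtain X where X: "X \<subseteq> \<alpha>" "card X = Suc k"
      using obtain_subset_with_card_n[of "Suc k" \<alpha>] \<alpha>(2) by (metis Suc_n_not_le_n nle_le)
    then obtain i j where ij: "X = {i, j}" "i \<noteq> j"
      unfolding k by (metis card_2_iff numeral_2_eq_2 One_nat_def)
    then have lt: "i < n" "j < n" using X(1) \<alpha>(1) by auto
    then have "f i i = 0" "f j j = 0" using zero[of "{i}"] zero[of "{j}"] k by simp_all
    then have "principal_minor f {i, j} = - (f i j)\<^sup>2"
      using ij sym[rule_format, of i j] lt by (simp add: principal_minor_2 power2_eq_square)
    then show False using pos[of "{i, j}"] X ij lt by simp
  qed
  obtain \<gamma> a b where \<gamma>: "\<gamma> \<subseteq> \<alpha> \<union> \<beta>" "card \<gamma> = Suc (Suc (Suc k))" and ab: "a \<in> \<gamma>" "b \<in> \<gamma>"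
    and ga: "principal_minor f (\<gamma> - {a}) > 0" and gb: "\<not> principal_minor f (\<gamma> - {b}) > 0"
    using exchange_pair[of \<alpha> \<beta> "Suc (Suc k)" "\<lambda>X. principal_minor f X > 0"] \<alpha> \<beta> fin by force
  have \<gamma>n: "\<gamma> \<subseteq> {..<n}" using \<gamma>(1) \<alpha>(1) \<beta>(1) by blast
  have sub: "\<gamma> - S \<subseteq> {..<n}" for S using \<gamma>n by blast
  have lt: "u < n" if "u \<in> \<gamma>" for u using that \<gamma>n by auto
  have "card (\<gamma> - {b}) = Suc (Suc k)" using ab \<gamma>(2) fin[OF \<gamma>n] by simp
  then have gb: "principal_minor f (\<gamma> - {b}) < 0" using gb nz[OF sub] by (metis linorder_neqE)
  have neab: "a \<noteq> b" using ga gb by auto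
  define d where "d = principal_minor f \<gamma>"
  (* pivoting at the complement of a, a zero minor of the whole set would force the minor without b
     to be a nonnegative multiple of the minor without a *)
  have d0: "d \<noteq> 0"
  proof
    assume d: "d = 0"
    have ga0: "principal_minor f (\<gamma> - {a}) \<noteq> 0" using ga by simp
    obtain c where c: "\<forall>X \<subseteq> {..<n}. principal_minor f (sym_diff (\<gamma> - {a}) X)
        = principal_minor f (\<gamma> - {a}) * principal_minor c X"
      "\<forall>i < n. \<forall>j < n. c j i = (if i \<in> \<gamma> - {a} \<longleftrightarrow> j \<in> \<gamma> - {a} then c i j else - c i j)"
      using real_symmetric_pivot_transform[OF sym sub ga0] by (elim exE conjE)
    have "sym_diff (\<gamma> - {a}) {a} = \<gamma>" using ab by auto
    then have "c a a = 0"
      using c(1)[rule_format, of "{a}"] lt[OF ab(1)] ga d by (simp add: d_def)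
    moreover have "c b a = - c a b"
      using c(2)[rule_format, of a b] lt ab neab by simp
    moreover have "sym_diff (\<gamma> - {a}) {a, b} = \<gamma> - {b}" using ab neab by auto
    ultimately have "principal_minor f (\<gamma> - {b}) = principal_minor f (\<gamma> - {a}) * (c a b)\<^sup>2"
      using c(1)[rule_format, of "{a, b}"] lt ab neab by (simp add: principal_minor_2 power2_eq_square)
    then show False using ga gb by (metis mult_nonneg_nonneg not_less order_less_imp_le zero_le_power2)
  qed
  obtain c where c: "\<forall>X \<subseteq> {..<n}. principal_minor f (sym_diff \<gamma> X) = d * principal_minor c X"
    "\<forall>i < n. \<forall>j < n. c j i = (if i \<in> \<gamma> \<longleftrightarrow> j \<in> \<gamma> then c i j else - c i j)"
    using real_symmetric_pivot_transform[OF sym \<gamma>n d0[unfolded d_def]] unfolding d_def by (elim exE conjE)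
  have complement: "principal_minor f (\<gamma> - X) = d * principal_minor c X" if "X \<subseteq> \<gamma>" for X
  proof -
    have "sym_diff \<gamma> X = \<gamma> - X" "X \<subseteq> {..<n}" using that \<gamma>n by blast+
    then show ?thesis using c(1) by metis
  qed
  have card: "card (\<gamma> - X) = Suc (Suc (Suc k)) - card X" if "X \<subseteq> \<gamma>" for X
    using that \<gamma>(2) fin[OF \<gamma>n] finite_subset[OF that] by (simp add: card_Diff_subset)
  (* c is antisymmetric between the indices of \<gamma> and the others; c' is symmetric everywhere *)
  define c' where "c' i j = (if i \<in> \<gamma> \<and> j \<in> \<gamma> then c i j else 0)" for i j
  have sym': "\<forall>i<n. \<forall>j<n. c' j i = c' i j"
  proof (intro allI impI)
    fix i j assume "i < n" "j < n"
    then show "c' j i = c' i j" using c(2)[rule_format, of i j] by (auto simp: c'_def)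
  qed
  have cc': "principal_minor c' X = principal_minor c X" if "X \<subseteq> \<gamma>" for X
    by (rule principal_minor_cong) (use that in \<open>auto simp: c'_def\<close>)
  have compl: "principal_minor f (\<gamma> - X) = d * principal_minor c' X" if "X \<subseteq> \<gamma>" for X
    using complement[OF that] cc'[OF that] by simp
  have diag: "c' u u \<noteq> 0" if "u \<in> \<gamma>" for u
    using compl[of "{u}"] card[of "{u}"] nz[OF sub, of "{u}"] that by auto
  have mixed: "c' a a * c' b b < 0"
  proof -
    have "d\<^sup>2 * (c' a a * c' b b) = principal_minor f (\<gamma> - {a}) * principal_minor f (\<gamma> - {b})"
      using compl[of "{a}"] compl[of "{b}"] ab by (simp add: power2_eq_square)
    also have "\<dots> < 0" using ga gb by (rule mult_pos_neg)
    finally show ?thesis using d0 by (simp add: mult_less_0_iff)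
  qed
  have two_pos: "d * principal_minor c' {u, v} > 0" if "u \<in> \<gamma>" "v \<in> \<gamma>" "u \<noteq> v" for u v
    using compl[of "{u, v}"] card[of "{u, v}"] pos[OF sub, of "{u, v}"] that by simp
  have "principal_minor c' {a, b} = c' a a * c' b b - (c' a b)\<^sup>2"
    using sym'[rule_format, of a b] lt ab neab by (simp add: principal_minor_2 power2_eq_square)
  then have "principal_minor c' {a, b} < 0"
    using mixed zero_le_power2[of "c' a b"] by linarith
  then have "d < 0"
    using two_pos[OF ab neab] by (simp add: zero_less_mult_iff)
  then have two: "principal_minor c' {u, v} < 0" if "u \<in> \<gamma>" "v \<in> \<gamma>" "u \<noteq> v" for u v
    using two_pos[OF that] by (simp add: zero_less_mult_iff)
  have three: "principal_minor c' {u, v, w} = 0"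
    if "u \<in> \<gamma>" "v \<in> \<gamma>" "w \<in> \<gamma>" "u \<noteq> v" "u \<noteq> w" "v \<noteq> w" for u v w
    using compl[of "{u, v, w}"] card[of "{u, v, w}"] zero[OF sub, of "{u, v, w}"] that d0 by simp
  have "card (\<gamma> - {a, b}) = Suc k" using card[of "{a, b}"] ab neab by simp
  then have nzab: "principal_minor f (\<gamma> - {a, b}) \<noteq> 0" using pos[OF sub] by (metis less_irrefl)
  have "\<gamma> - {a, b} \<noteq> {}" using \<open>card (\<gamma> - {a, b}) = Suc k\<close> by force
  then obtain i where i: "i \<in> \<gamma> - {a, b}" by blast
  have "\<gamma> - {a, b} - {i} = \<gamma> - {a, b, i}" by auto
  then have "principal_minor f (\<gamma> - {a, b} - {i}) = 0"
    using zero[OF sub] card[of "{a, b, i}"] ab neab i by simp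
  then obtain j where j: "j \<in> \<gamma> - {a, b} - {i}" "principal_minor f (\<gamma> - {a, b} - {i, j}) \<noteq> 0"
    by (rule real_nonzero_two_below[OF sym sub nzab i])
  have "\<gamma> - {a, b} - {i, j} = \<gamma> - {a, b, i, j}" by auto
  then have quad: "principal_minor c' {a, b, i, j} \<noteq> 0"
    using j compl[of "{a, b, i, j}"] ab i by auto
  have "card (\<gamma> - {a, b, i, j}) = k - 1" using card[of "{a, b, i, j}"] ab neab i j by simp
  then have "card (\<gamma> - {a, b, i, j}) \<noteq> 0" using k0 k1 by simp
  then have "\<gamma> - {a, b, i, j} \<noteq> {}" by force
  then obtain e where e: "e \<in> \<gamma> - {a, b, i, j}" by blast
  have mem: "a \<in> \<gamma>" "b \<in> \<gamma>" "i \<in> \<gamma>" "j \<in> \<gamma>" "e \<in> \<gamma>"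
    and ne: "distinct [a, b, i, j, e]" using ab neab i j e by auto
  have parity: "((principal_minor c' {p, x, y, z} = 0) = (principal_minor c' {p, x, y, w} = 0))
      = ((principal_minor c' {p, x, z, w} = 0) = (principal_minor c' {p, y, z, w} = 0))"
    if "p \<in> \<gamma>" "x \<in> \<gamma>" "y \<in> \<gamma>" "z \<in> \<gamma>" "w \<in> \<gamma>" "distinct [p, x, y, z, w]" for p x y z w
    by (rule real_symmetric_quads_parity[OF sym']) (use that lt diag two three in auto)
  have "principal_minor c' {b, i, j, e} \<noteq> 0" "principal_minor c' {a, i, j, e} \<noteq> 0"
    using parity[of a b i j e] parity[of b a i j e] parity[of e a b i j] quad mem ne
    by (simp_all add: insert_commute) argo+
  then have "c' b b * c' i i * c' j j * c' e e > 0" "c' a a * c' i i * c' j j * c' e e > 0"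
    using real_symmetric_quad_diagonal[OF sym', of b i j e] real_symmetric_quad_diagonal[OF sym', of a i j e]
      mem ne lt three diag by simp_all
  then have "(c' b b * c' i i * c' j j * c' e e) * (c' a a * c' i i * c' j j * c' e e) > 0"
    by (rule mult_pos_pos)
  also have "(c' b b * c' i i * c' j j * c' e e) * (c' a a * c' i i * c' j j * c' e e)
      = (c' a a * c' b b) * (c' i i * c' j j * c' e e)\<^sup>2"
    by (simp only: power2_eq_square mult_ac)
  finally show False
    using mixed by (metis mult_nonpos_nonneg not_less order_less_imp_le zero_le_power2)
qed

section \<open>Necessary conditions on three consecutive terms\<close>
definition symbol_of_signs :: "bool \<Rightarrow> bool \<Rightarrow> bool \<Rightarrow> sepr_symbol" where
  "symbol_of_signs p m z =
     (if z then if p then if m then S_star else S_plus else if m then S_minus else N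
      else if p then if m then A_star else A_plus else A_minus)"

definition has_pos :: "sepr_symbol \<Rightarrow> bool" where
  "has_pos s \<longleftrightarrow> s = A_star \<or> s = A_plus \<or> s = S_star \<or> s = S_plus"

definition has_neg :: "sepr_symbol \<Rightarrow> bool" where
  "has_neg s \<longleftrightarrow> s = A_star \<or> s = A_minus \<or> s = S_star \<or> s = S_minus"

definition has_zero :: "sepr_symbol \<Rightarrow> bool" where
  "has_zero s \<longleftrightarrow> s = N \<or> s = S_star \<or> s = S_plus \<or> s = S_minus"

lemma signs_of_symbol_of_signs:
  assumes "p \<or> m \<or> z"
  shows "has_pos (symbol_of_signs p m z) = p" "has_neg (symbol_of_signs p m z) = m"
    "has_zero (symbol_of_signs p m z) = z"
  using assms by (auto simp: symbol_of_signs_def has_pos_def has_neg_def has_zero_def)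

lemma hermitian_mat_entries:
  assumes "hermitian_mat B"
  shows "B \<in> carrier_mat (dim_row B) (dim_row B)"
    and "\<forall>i<dim_row B. \<forall>j<dim_row B. B $$ (j, i) = cnj (B $$ (i, j))"
proof -
  show B: "B \<in> carrier_mat (dim_row B) (dim_row B)"
    using assms by (auto simp: hermitian_mat_def)
  have adj: "mat_adjoint B = B" using assms unfolding hermitian_mat_def by blast
  have sq: "dim_col B = dim_row B" using B by (rule carrier_matD(2))
  have "mat_adjoint B $$ (j, i) = cnj (B $$ (i, j))" if "i < dim_row B" "j < dim_row B" for i j
    using that by (simp add: mat_adjoint_def mat_of_rows_index sq)
  then show "\<forall>i<dim_row B. \<forall>j<dim_row B. B $$ (j, i) = cnj (B $$ (i, j))"
    unfolding adj by blast
qed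

lemma principal_minors_eq:
  assumes "B \<in> carrier_mat n n"
  shows "principal_minors B k
    = {principal_minor (\<lambda>i j. B $$ (i, j)) X | X. X \<subseteq> {..<n} \<and> card X = k}"
proof -
  have n: "dim_row B = n" "{0..<n} = {..<n}" using assms by auto
  show ?thesis
    unfolding principal_minors_def n using det_submatrix[OF assms] by (metis (mono_tags, lifting))
qed

lemma sepr_term_eq_symbol_of_signs:
  assumes herm: "hermitian_mat B" and k: "k \<le> dim_row B"
  defines "R \<equiv> {Re (principal_minor (\<lambda>i j. B $$ (i, j)) X) | X. X \<subseteq> {..<dim_row B} \<and> card X = k}"
  shows "sepr_term B k = symbol_of_signs (\<exists>x\<in>R. x > 0) (\<exists>x\<in>R. x < 0) (\<exists>x\<in>R. x = 0)"
    and "R \<noteq> {}"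
proof -
  note B = hermitian_mat_entries[OF herm]
  obtain X where "X \<subseteq> {..<dim_row B}" "card X = k"
    using obtain_subset_with_card_n[of k "{..<dim_row B}"] k by auto
  then show ne: "R \<noteq> {}" by (auto simp: R_def)
  have real: "principal_minor (\<lambda>i j. B $$ (i, j)) X
      = of_real (Re (principal_minor (\<lambda>i j. B $$ (i, j)) X))" if "X \<subseteq> {..<dim_row B}" for X
  proof -
    have "Im (principal_minor (\<lambda>i j. B $$ (i, j)) X) = 0"
      using that B(2) by (intro hermitian_principal_minor_real finite_subset[OF that finite_lessThan]) blast
    then show ?thesis by (simp add: complex_eq_iff)
  qed
  have "principal_minors B k = of_real ` R"
    unfolding principal_minors_eq[OF B(1)] R_def setcompr_eq_image image_image
    by (intro image_cong refl real) simp
  then have all: "(\<forall>z\<in>principal_minors B k. P z) \<longleftrightarrow> (\<forall>x\<in>R. P (of_real x))"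
    and ex: "(\<exists>z\<in>principal_minors B k. P z) \<longleftrightarrow> (\<exists>x\<in>R. P (of_real x))" for P
    by auto
  have ord: "complex_of_real x > 0 \<longleftrightarrow> x > 0" "complex_of_real x < 0 \<longleftrightarrow> x < 0" for x
    by (auto simp: less_complex_def)
  have sgn: "(\<forall>x\<in>R. x > 0) \<longleftrightarrow> \<not> (\<exists>x\<in>R. x < 0) \<and> \<not> (\<exists>x\<in>R. x = 0)"
    "(\<forall>x\<in>R. x < 0) \<longleftrightarrow> \<not> (\<exists>x\<in>R. x > 0) \<and> \<not> (\<exists>x\<in>R. x = 0)"
    "(\<forall>x\<in>R. x = 0) \<longleftrightarrow> \<not> (\<exists>x\<in>R. x > 0) \<and> \<not> (\<exists>x\<in>R. x < 0)"
    "(\<forall>x\<in>R. x \<noteq> 0) \<longleftrightarrow> \<not> (\<exists>x\<in>R. x = 0)"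
    "(\<exists>x\<in>R. x \<noteq> 0) \<longleftrightarrow> (\<exists>x\<in>R. x > 0) \<or> (\<exists>x\<in>R. x < 0)"
    "(\<forall>x\<in>R. x \<noteq> 0 \<longrightarrow> x > 0) \<longleftrightarrow> \<not> (\<exists>x\<in>R. x < 0)"
  proof -
    have "(\<forall>x\<in>R. x > 0) \<longleftrightarrow> (\<forall>x\<in>R. \<not> x < 0 \<and> \<not> x = 0)"
      "(\<forall>x\<in>R. x < 0) \<longleftrightarrow> (\<forall>x\<in>R. \<not> x > 0 \<and> \<not> x = 0)"
      "(\<forall>x\<in>R. x = 0) \<longleftrightarrow> (\<forall>x\<in>R. \<not> x > 0 \<and> \<not> x < 0)"
      "(\<exists>x\<in>R. x \<noteq> 0) \<longleftrightarrow> (\<exists>x\<in>R. x > 0 \<or> x < 0)"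
      "(\<forall>x\<in>R. x \<noteq> 0 \<longrightarrow> x > 0) \<longleftrightarrow> (\<forall>x\<in>R. \<not> x < 0)"
      by (intro ball_cong bex_cong; auto)+
    then show "(\<forall>x\<in>R. x > 0) \<longleftrightarrow> \<not> (\<exists>x\<in>R. x < 0) \<and> \<not> (\<exists>x\<in>R. x = 0)"
      "(\<forall>x\<in>R. x < 0) \<longleftrightarrow> \<not> (\<exists>x\<in>R. x > 0) \<and> \<not> (\<exists>x\<in>R. x = 0)"
      "(\<forall>x\<in>R. x = 0) \<longleftrightarrow> \<not> (\<exists>x\<in>R. x > 0) \<and> \<not> (\<exists>x\<in>R. x < 0)"
      "(\<forall>x\<in>R. x \<noteq> 0) \<longleftrightarrow> \<not> (\<exists>x\<in>R. x = 0)"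
      "(\<exists>x\<in>R. x \<noteq> 0) \<longleftrightarrow> (\<exists>x\<in>R. x > 0) \<or> (\<exists>x\<in>R. x < 0)"
      "(\<forall>x\<in>R. x \<noteq> 0 \<longrightarrow> x > 0) \<longleftrightarrow> \<not> (\<exists>x\<in>R. x < 0)"
      by blast+
  qed
  have some: "(\<exists>x\<in>R. x > 0) \<or> (\<exists>x\<in>R. x < 0) \<or> (\<exists>x\<in>R. x = 0)"
    proof -
    obtain x where "x \<in> R" using ne by blast
    moreover have "x > 0 \<or> x < 0 \<or> x = 0" by linarith
    ultimately show ?thesis by blast
  qed
  define p where "p \<longleftrightarrow> (\<exists>x\<in>R. x > 0)"
  define m where "m \<longleftrightarrow> (\<exists>x\<in>R. x < 0)"
  define z where "z \<longleftrightarrow> (\<exists>x\<in>R. x = 0)"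
  show "sepr_term B k = symbol_of_signs (\<exists>x\<in>R. x > 0) (\<exists>x\<in>R. x < 0) (\<exists>x\<in>R. x = 0)"
    using some
    unfolding sepr_term_def Let_def all ex ord of_real_eq_0_iff sgn symbol_of_signs_def
      p_def[symmetric] m_def[symmetric] z_def[symmetric]
    by (cases p; cases m; cases z; simp)
qed

lemma sepr_term_signs:
  assumes "hermitian_mat B" and "k \<le> dim_row B"
  shows "has_pos (sepr_term B k) \<longleftrightarrow>
      (\<exists>X \<subseteq> {..<dim_row B}. card X = k \<and> Re (principal_minor (\<lambda>i j. B $$ (i, j)) X) > 0)"
    and "has_neg (sepr_term B k) \<longleftrightarrow>
      (\<exists>X \<subseteq> {..<dim_row B}. card X = k \<and> Re (principal_minor (\<lambda>i j. B $$ (i, j)) X) < 0)"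
    and "has_zero (sepr_term B k) \<longleftrightarrow>
      (\<exists>X \<subseteq> {..<dim_row B}. card X = k \<and> Re (principal_minor (\<lambda>i j. B $$ (i, j)) X) = 0)"
proof -
  define R where "R = {Re (principal_minor (\<lambda>i j. B $$ (i, j)) X) | X. X \<subseteq> {..<dim_row B} \<and> card X = k}"
  note R = sepr_term_eq_symbol_of_signs[OF assms, folded R_def]
  have "(\<exists>x\<in>R. x > 0) \<or> (\<exists>x\<in>R. x < 0) \<or> (\<exists>x\<in>R. x = 0)"
  proof -
    obtain x where "x \<in> R" using R(2) by blast
    moreover have "x > 0 \<or> x < 0 \<or> x = 0" by linarith
    ultimately show ?thesis by blast
  qed
  note signs = signs_of_symbol_of_signs[OF this, folded R(1)]
  show "has_pos (sepr_term B k) \<longleftrightarrow>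
      (\<exists>X \<subseteq> {..<dim_row B}. card X = k \<and> Re (principal_minor (\<lambda>i j. B $$ (i, j)) X) > 0)"
    "has_neg (sepr_term B k) \<longleftrightarrow>
      (\<exists>X \<subseteq> {..<dim_row B}. card X = k \<and> Re (principal_minor (\<lambda>i j. B $$ (i, j)) X) < 0)"
    "has_zero (sepr_term B k) \<longleftrightarrow>
      (\<exists>X \<subseteq> {..<dim_row B}. card X = k \<and> Re (principal_minor (\<lambda>i j. B $$ (i, j)) X) = 0)"
    unfolding signs by (auto simp: R_def)
qed

lemma sublist_sepr_triple:
  "sublist [a, b, c] (sepr B) \<longleftrightarrow>
    (\<exists>k. Suc (Suc (Suc k)) \<le> dim_row B \<and> a = sepr_term B (Suc k) \<and>
      b = sepr_term B (Suc (Suc k)) \<and> c = sepr_term B (Suc (Suc (Suc k))))"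
    (is "?l \<longleftrightarrow> ?r")
proof
  assume ?l
  then obtain ps ss where s: "sepr B = ps @ [a, b, c] @ ss" by (auto simp: sublist_def)
  have len: "length (sepr B) = dim_row B" by (simp add: sepr_def)
  have nth: "sepr B ! i = sepr_term B (Suc i)" if "i < dim_row B" for i
    using that by (simp add: sepr_def del: upt_Suc)
  have l: "Suc (Suc (Suc (length ps))) \<le> dim_row B" unfolding len[symmetric] s by simp
  have "sepr B ! length ps = a" "sepr B ! Suc (length ps) = b" "sepr B ! Suc (Suc (length ps)) = c"
    unfolding s by (simp_all add: nth_append)
  then show ?r using l nth by (intro exI[of _ "length ps"]) auto
next
  assume ?r
  then obtain k where k: "Suc (Suc (Suc k)) \<le> dim_row B" "a = sepr_term B (Suc k)"
      "b = sepr_term B (Suc (Suc k))" "c = sepr_term B (Suc (Suc (Suc k)))" by blast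
  let ?n = "dim_row B"
  have "[1..<Suc ?n] = [1..<Suc k] @ [Suc k..<Suc ?n]"
    using k(1) upt_add_eq_append[of 1 "Suc k" "?n - k"] by simp
  also have "[Suc k..<Suc ?n] = [Suc k, Suc (Suc k), Suc (Suc (Suc k))] @ [Suc (Suc (Suc (Suc k)))..<Suc ?n]"
    using k(1) by (simp add: upt_conv_Cons)
  finally have "sepr B = map (sepr_term B) [1..<Suc k] @ [a, b, c]
      @ map (sepr_term B) [Suc (Suc (Suc (Suc k)))..<Suc ?n]"
    unfolding sepr_def k(2-4) by simp
  then show ?l unfolding sublist_def by blast
qed

text \<open>
  For the terms of two orders: some minor of the one order and some minor of the other have
  opposite signs.
\<close>
definition opposite :: "sepr_symbol \<Rightarrow> sepr_symbol \<Rightarrow> bool" where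
  "opposite s t \<longleftrightarrow> has_pos s \<and> has_neg t \<or> has_neg s \<and> has_pos t"

text \<open>
  The first clause, and the first line of the second, are the fact about both signs applied to the
  middle order, and to the outer orders when the middle one is \<open>N\<close>. The rest is the
  fact about two deletions: a nonzero minor in the last order which contains a zero minor of the
  middle order needs a minor of the opposite sign in the first order.
\<close>
definition hermitian_admissible :: "sepr_symbol \<Rightarrow> sepr_symbol \<Rightarrow> sepr_symbol \<Rightarrow> bool" where
  "hermitian_admissible a b c \<longleftrightarrow>
     (has_pos b \<and> has_neg b \<longrightarrow> opposite a c) \<and>
     (b = N \<longrightarrow> \<not> (has_pos a \<and> has_neg a) \<and> \<not> (has_pos c \<and> has_neg c) \<and>
        (has_pos c \<longrightarrow> has_neg a) \<and> (has_neg c \<longrightarrow> has_pos a)) \<and>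
     (has_zero b \<and> \<not> has_zero c \<longrightarrow> opposite a c)"

lemma occurs_hermitian_admissible:
  assumes "occurs_hermitian [a, b, c]"
  shows "hermitian_admissible a b c"
proof -
  obtain B k where B: "hermitian_mat B" and k: "Suc (Suc (Suc k)) \<le> dim_row B"
    and abc: "a = sepr_term B (Suc k)" "b = sepr_term B (Suc (Suc k))" "c = sepr_term B (Suc (Suc (Suc k)))"
    using assms unfolding occurs_hermitian_def sublist_sepr_triple by blast
  define n where "n = dim_row B"
  define f where "f i j = B $$ (i, j)" for i j
  define g where "g X = Re (principal_minor f X)" for X
  have herm: "\<forall>i<n. \<forall>j<n. f j i = cnj (f i j)"
    unfolding f_def n_def by (rule hermitian_mat_entries(2)[OF B])
  have signs: "has_pos (sepr_term B l) \<longleftrightarrow> (\<exists>X\<subseteq>{..<n}. card X = l \<and> g X > 0)"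
    "has_neg (sepr_term B l) \<longleftrightarrow> (\<exists>X\<subseteq>{..<n}. card X = l \<and> g X < 0)"
    "has_zero (sepr_term B l) \<longleftrightarrow> (\<exists>X\<subseteq>{..<n}. card X = l \<and> g X = 0)" if "l \<le> n" for l
    using sepr_term_signs[OF B, of l] that unfolding n_def g_def f_def by blast+
  have k': "Suc k \<le> n" "Suc (Suc k) \<le> n" "Suc (Suc (Suc k)) \<le> n" using k by (simp_all add: n_def)
  note sa = signs[OF k'(1), folded abc(1)] and sb = signs[OF k'(2), folded abc(2)]
    and sc = signs[OF k'(3), folded abc(3)]
  have N: "s = N \<longleftrightarrow> \<not> has_pos s \<and> \<not> has_neg s" for s
    by (cases s) (auto simp: has_pos_def has_neg_def)
  have mixed: "\<exists>A Z. A \<subseteq> {..<n} \<and> Suc (card A) = l \<and> Z \<subseteq> {..<n} \<and> card Z = Suc l \<and> g A * g Z < 0"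
    if "X \<subseteq> {..<n}" "card X = l" "g X > 0" "Y \<subseteq> {..<n}" "card Y = l" "g Y < 0" for X Y l
  proof -
    have "Re (principal_minor f X) * Re (principal_minor f Y) < 0"
      using mult_pos_neg[OF that(3,6)] unfolding g_def .
    from opposite_signs_in_neighbouring_orders[OF herm that(1,2,4,5) this]
    show ?thesis unfolding g_def .
  qed
  have below: "\<exists>A\<subseteq>{..<n}. card A = Suc k \<and> g Z * g A < 0"
    if Z: "Z \<subseteq> {..<n}" "card Z = Suc (Suc (Suc k))" "g Z \<noteq> 0" "i \<in> Z" "g (Z - {i}) = 0" for Z i
  proof -
    obtain j where j: "j \<in> Z - {i}" "g Z * g (Z - {i, j}) < 0"
      using opposite_sign_two_below[OF herm Z(1) Z(3)[unfolded g_def] Z(4) Z(5)[unfolded g_def]]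
      unfolding g_def .
    have "finite Z" using Z(1) finite_subset by blast
    then have "card (Z - {i, j}) = Suc k" using Z(2,4) j by (simp add: card_Diff_subset)
    then show ?thesis using j(2) Z(1) by blast
  qed
  have case_mixed: "opposite a c" if pm: "has_pos b \<and> has_neg b"
  proof -
    obtain X Y where "X \<subseteq> {..<n}" "card X = Suc (Suc k)" "g X > 0"
      "Y \<subseteq> {..<n}" "card Y = Suc (Suc k)" "g Y < 0"
      using pm unfolding sb by blast
    from mixed[OF this] obtain A Z where "A \<subseteq> {..<n}" "card A = Suc k"
      "Z \<subseteq> {..<n}" "card Z = Suc (Suc (Suc k))" "g A * g Z < 0"
      by auto
    then show ?thesis unfolding opposite_def sa sc mult_less_0_iff by blast
  qed
  have case_N: "\<not> (has_pos a \<and> has_neg a) \<and> \<not> (has_pos c \<and> has_neg c) \<and>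
        (has_pos c \<longrightarrow> has_neg a) \<and> (has_neg c \<longrightarrow> has_pos a)" if b: "b = N"
  proof -
    have 1: "\<not> (has_pos a \<and> has_neg a)"
    proof
      assume "has_pos a \<and> has_neg a"
      then obtain X Y where "X \<subseteq> {..<n}" "card X = Suc k" "g X > 0"
        "Y \<subseteq> {..<n}" "card Y = Suc k" "g Y < 0"
        unfolding sa by blast
      from mixed[OF this] obtain A Z where "Z \<subseteq> {..<n}" "card Z = Suc (Suc k)" "g A * g Z < 0"
        by auto
      then show False using b unfolding N sb mult_less_0_iff by blast
    qed
    have 2: "\<not> (has_pos c \<and> has_neg c)"
    proof
      assume "has_pos c \<and> has_neg c"
      then obtain X Y where "X \<subseteq> {..<n}" "card X = Suc (Suc (Suc k))" "g X > 0"
        "Y \<subseteq> {..<n}" "card Y = Suc (Suc (Suc k))" "g Y < 0"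
        unfolding sc by blast
      from mixed[OF this] obtain A Z where "A \<subseteq> {..<n}" "card A = Suc (Suc k)" "g A * g Z < 0"
        by auto
      then show False using b unfolding N sb mult_less_0_iff by blast
    qed
    have zero: "g X = 0" if "X \<subseteq> {..<n}" "card X = Suc (Suc k)" for X
    proof -
      have "\<not> g X > 0" "\<not> g X < 0" using b that unfolding N sb by blast+
      then show ?thesis by linarith
    qed
    have down: "\<exists>A\<subseteq>{..<n}. card A = Suc k \<and> g Z * g A < 0"
      if Z: "Z \<subseteq> {..<n}" "card Z = Suc (Suc (Suc k))" "g Z \<noteq> 0" for Z
    proof -
      have "Z \<noteq> {}" using Z(2) by auto
      then obtain i where i: "i \<in> Z" by blast
      have "card (Z - {i}) = Suc (Suc k)" "Z - {i} \<subseteq> {..<n}" using i Z(1,2) by auto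
      then have "g (Z - {i}) = 0" by (intro zero)
      then show ?thesis by (rule below[OF Z i])
    qed
    have 3: "has_neg a" if pc: "has_pos c"
    proof -
      obtain Z where Z: "Z \<subseteq> {..<n}" "card Z = Suc (Suc (Suc k))" "g Z > 0"
        using pc unfolding sc by blast
      then obtain A where "A \<subseteq> {..<n}" "card A = Suc k" "g A < 0"
        using down[of Z] by (auto simp: mult_less_0_iff)
      then show ?thesis unfolding sa by blast
    qed
    have 4: "has_pos a" if nc: "has_neg c"
    proof -
      obtain Z where Z: "Z \<subseteq> {..<n}" "card Z = Suc (Suc (Suc k))" "g Z < 0"
        using nc unfolding sc by blast
      then obtain A where "A \<subseteq> {..<n}" "card A = Suc k" "g A > 0"
        using down[of Z] by (auto simp: mult_less_0_iff)
      then show ?thesis unfolding sa by blast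
    qed
    show ?thesis using 1 2 3 4 by blast
  qed
  have case_zero: "opposite a c" if bc: "has_zero b \<and> \<not> has_zero c"
  proof -
    obtain X where X: "X \<subseteq> {..<n}" "card X = Suc (Suc k)" "g X = 0"
      using bc unfolding sb by blast
    have "\<not> {..<n} \<subseteq> X" using card_mono[OF finite_subset[OF X(1)], of "{..<n}"] X(2) k'(3) by auto
    then obtain i where i: "i < n" "i \<notin> X" by blast
    have Z: "insert i X \<subseteq> {..<n}" "card (insert i X) = Suc (Suc (Suc k))"
      using i X finite_subset[OF X(1)] by auto
    then have nz: "g (insert i X) \<noteq> 0" using bc unfolding sc by blast
    have "insert i X - {i} = X" using i by auto
    then obtain A where "A \<subseteq> {..<n}" "card A = Suc k" "g (insert i X) * g A < 0"
      using below[OF Z nz, of i] X(3) by auto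
    then show ?thesis unfolding opposite_def sa sc mult_less_0_iff using Z by blast
  qed
  show ?thesis
    unfolding hermitian_admissible_def using case_mixed case_N case_zero by blast
qed

section \<open>Real symmetric matrices\<close>
lemma real_symmetric_mat_entries:
  assumes "real_symmetric_mat A"
  shows "A \<in> carrier_mat (dim_row A) (dim_row A)"
    and "\<forall>i<dim_row A. \<forall>j<dim_row A. A $$ (j, i) = A $$ (i, j)"
proof -
  have sq: "dim_col A = dim_row A" and t: "transpose_mat A = A"
    using assms by (simp_all add: real_symmetric_mat_def)
  then show "A \<in> carrier_mat (dim_row A) (dim_row A)" by (intro carrier_matI) simp_all
  have "transpose_mat A $$ (i, j) = A $$ (j, i)" if "i < dim_row A" "j < dim_row A" for i j
    using that sq by simp
  then show "\<forall>i<dim_row A. \<forall>j<dim_row A. A $$ (j, i) = A $$ (i, j)"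
    unfolding t by metis
qed

lemma hermitian_mat_of_real_symmetric:
  assumes "real_symmetric_mat A"
  shows "hermitian_mat (map_mat complex_of_real A)"
proof -
  have sq: "dim_col A = dim_row A" using assms by (simp add: real_symmetric_mat_def)
  show ?thesis
    unfolding hermitian_mat_def using sq real_symmetric_mat_entries(2)[OF assms]
    by (intro conjI eq_matI) (simp_all add: mat_adjoint_def mat_of_rows_index)
qed

lemma occurs_real_symmetric_imp_hermitian:
  assumes "occurs_real_symmetric \<sigma>"
  shows "occurs_hermitian \<sigma>"
proof -
  obtain A where "real_symmetric_mat A" "dim_row A > 0" "sublist \<sigma> (sepr (map_mat complex_of_real A))"
    using assms unfolding occurs_real_symmetric_def by blast
  then show ?thesis
    unfolding occurs_hermitian_def
    by (intro exI[of _ "map_mat complex_of_real A"]) (simp add: hermitian_mat_of_real_symmetric)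
qed

lemma real_symmetric_sepr_term:
  assumes A: "real_symmetric_mat A" and k: "k \<le> dim_row A"
  defines "R \<equiv> {principal_minor (\<lambda>i j. A $$ (i, j)) X | X. X \<subseteq> {..<dim_row A} \<and> card X = k}"
  shows "sepr_term (map_mat complex_of_real A) k
      = symbol_of_signs (\<exists>x\<in>R. x > 0) (\<exists>x\<in>R. x < 0) (\<exists>x\<in>R. x = 0)"
    and "(\<exists>x\<in>R. x > 0) \<or> (\<exists>x\<in>R. x < 0) \<or> (\<exists>x\<in>R. x = 0)"
proof -
  let ?C = "map_mat complex_of_real A"
  have sq: "dim_col A = dim_row A" using A by (simp add: real_symmetric_mat_def)
  have "principal_minor (\<lambda>i j. ?C $$ (i, j)) X = of_real (principal_minor (\<lambda>i j. A $$ (i, j)) X)"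
    if "X \<subseteq> {..<dim_row A}" for X
  proof -
    have "principal_minor (\<lambda>i j. ?C $$ (i, j)) X = principal_minor (\<lambda>i j. of_real (A $$ (i, j))) X"
    proof (rule principal_minor_cong)
      fix i j assume "i \<in> X" "j \<in> X"
      then have "i < dim_row A" "j < dim_col A" using that sq by auto
      then show "?C $$ (i, j) = of_real (A $$ (i, j))" by simp
    qed
    then show ?thesis by (simp only: of_real_principal_minor)
  qed
  then have R: "{Re (principal_minor (\<lambda>i j. ?C $$ (i, j)) X) | X. X \<subseteq> {..<dim_row ?C} \<and> card X = k} = R"
    unfolding R_def setcompr_eq_image by (intro image_cong) simp_all
  have k': "k \<le> dim_row ?C" using k by simp
  note R_eq = sepr_term_eq_symbol_of_signs[OF hermitian_mat_of_real_symmetric[OF A] k', unfolded R]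
  show "sepr_term ?C k = symbol_of_signs (\<exists>x\<in>R. x > 0) (\<exists>x\<in>R. x < 0) (\<exists>x\<in>R. x = 0)"
    by (rule R_eq(1))
  obtain x where "x \<in> R" using R_eq(2) by blast
  moreover have "x > 0 \<or> x < 0 \<or> x = 0" by linarith
  ultimately show "(\<exists>x\<in>R. x > 0) \<or> (\<exists>x\<in>R. x < 0) \<or> (\<exists>x\<in>R. x = 0)" by blast
qed

text \<open>
  Negating a matrix multiplies the minors of order \<open>k\<close> by \<open>(-1)\<^sup>k\<close>. The first entry of the list has
  order 1, so the entries with even list index change.
\<close>
fun flip :: "sepr_symbol \<Rightarrow> sepr_symbol" where
  "flip A_plus = A_minus"
| "flip A_minus = A_plus"
| "flip S_plus = S_minus"
| "flip S_minus = S_plus"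
| "flip s = s"

fun flip_odd :: "sepr_symbol list \<Rightarrow> sepr_symbol list" where
  "flip_odd (s # t # ss) = flip s # t # flip_odd ss"
| "flip_odd [s] = [flip s]"
| "flip_odd [] = []"

lemma length_flip_odd [simp]: "length (flip_odd ss) = length ss"
  by (induction ss rule: flip_odd.induct) simp_all

lemma nth_flip_odd: "i < length ss \<Longrightarrow> flip_odd ss ! i = (if even i then flip (ss ! i) else ss ! i)"
proof (induction ss arbitrary: i rule: flip_odd.induct)
  case (1 s t ss)
  show ?case
  proof (cases i)
    case (Suc j)
    then show ?thesis using 1 by (cases j) auto
  qed simp
qed auto

lemma principal_minor_uminus:
  "principal_minor (\<lambda>i j. - f i j) X = (- 1) ^ card X * principal_minor f X"
proof -
  have "(\<Prod>i\<in>X. - f i (p i)) = (- 1) ^ card X * (\<Prod>i\<in>X. f i (p i))" for p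
    by (rule prod_uminus)
  then show ?thesis by (simp add: principal_minor_def sum_distrib_left mult_ac)
qed

lemma flip_symbol_of_signs:
  "p \<or> m \<or> z \<Longrightarrow> flip (symbol_of_signs p m z) = symbol_of_signs m p z"
  by (auto simp: symbol_of_signs_def)

lemma sepr_uminus:
  assumes A: "real_symmetric_mat A"
  shows "real_symmetric_mat (- A)"
    and "sepr (map_mat complex_of_real (- A)) = flip_odd (sepr (map_mat complex_of_real A))"
proof -
  have sq: "dim_col A = dim_row A" using A by (simp add: real_symmetric_mat_def)
  show A': "real_symmetric_mat (- A)"
    unfolding real_symmetric_mat_def using sq real_symmetric_mat_entries(2)[OF A]
    by (intro conjI eq_matI) simp_all
  have "sepr_term (map_mat complex_of_real (- A)) k
      = (if odd k then flip (sepr_term (map_mat complex_of_real A) k) else sepr_term (map_mat complex_of_real A) k)"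
    if k: "k \<le> dim_row A" for k
  proof -
    define S where "S = {X. X \<subseteq> {..<dim_row A} \<and> card X = k}"
    define g where "g = principal_minor (\<lambda>i j. A $$ (i, j))"
    have "principal_minor (\<lambda>i j. (- A) $$ (i, j)) X = (- 1) ^ k * g X" if "X \<in> S" for X
    proof -
      have "principal_minor (\<lambda>i j. (- A) $$ (i, j)) X = principal_minor (\<lambda>i j. - (A $$ (i, j))) X"
      proof (rule principal_minor_cong)
        fix i j assume "i \<in> X" "j \<in> X"
        then have "i < dim_row A" "j < dim_col A" using that sq by (auto simp: S_def)
        then show "(- A) $$ (i, j) = - (A $$ (i, j))" by simp
      qed
      then show ?thesis using that by (simp add: principal_minor_uminus S_def g_def)
    qed
    then have R': "{principal_minor (\<lambda>i j. (- A) $$ (i, j)) X | X. X \<subseteq> {..<dim_row (- A)} \<and> card X = k}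
        = (\<lambda>X. (- 1) ^ k * g X) ` S"
      unfolding setcompr_eq_image S_def by (intro image_cong) simp_all
    have R: "{principal_minor (\<lambda>i j. A $$ (i, j)) X | X. X \<subseteq> {..<dim_row A} \<and> card X = k} = g ` S"
      unfolding setcompr_eq_image S_def g_def ..
    have k': "k \<le> dim_row (- A)" using k by simp
    have zero: "0 \<in> (\<lambda>X. - g X) ` S \<longleftrightarrow> 0 \<in> g ` S" by force
    show ?thesis
      using real_symmetric_sepr_term[OF A' k', unfolded R'] real_symmetric_sepr_term[OF A k, unfolded R]
      by (cases "even k") (simp_all add: flip_symbol_of_signs zero)
  qed
  then show "sepr (map_mat complex_of_real (- A)) = flip_odd (sepr (map_mat complex_of_real A))"
    by (intro nth_equalityI) (simp_all add: sepr_def nth_flip_odd del: upt_Suc)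
qed

lemma occurs_real_symmetric_exceptions:
  assumes "occurs_real_symmetric [N, b, c]"
  shows "b = A_plus \<or> b = A_minus \<Longrightarrow> \<not> has_zero c" and "b = A_plus \<Longrightarrow> c \<noteq> A_star"
proof -
  obtain A k where A: "real_symmetric_mat A"
    and k: "Suc (Suc (Suc k)) \<le> dim_row (map_mat complex_of_real A)"
    and Nbc: "N = sepr_term (map_mat complex_of_real A) (Suc k)"
      "b = sepr_term (map_mat complex_of_real A) (Suc (Suc k))"
      "c = sepr_term (map_mat complex_of_real A) (Suc (Suc (Suc k)))"
    using assms unfolding occurs_real_symmetric_def sublist_sepr_triple by blast
  define n where "n = dim_row A"
  define f where "f i j = A $$ (i, j)" for i j
  have f_eq: "f = (\<lambda>i j. A $$ (i, j))" by (simp add: f_def fun_eq_iff)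
  define g where "g = principal_minor f"
  have sym: "\<forall>i<n. \<forall>j<n. f j i = f i j"
    unfolding f_def n_def by (rule real_symmetric_mat_entries(2)[OF A])
  have signs: "has_pos (sepr_term (map_mat complex_of_real A) l) \<longleftrightarrow> (\<exists>X\<subseteq>{..<n}. card X = l \<and> g X > 0)"
    "has_neg (sepr_term (map_mat complex_of_real A) l) \<longleftrightarrow> (\<exists>X\<subseteq>{..<n}. card X = l \<and> g X < 0)"
    "has_zero (sepr_term (map_mat complex_of_real A) l) \<longleftrightarrow> (\<exists>X\<subseteq>{..<n}. card X = l \<and> g X = 0)"
    if "l \<le> n" for l
  proof -
    have l: "l \<le> dim_row A" using that by (simp add: n_def)
    note R = real_symmetric_sepr_term[OF A l]
    show "has_pos (sepr_term (map_mat complex_of_real A) l) \<longleftrightarrow> (\<exists>X\<subseteq>{..<n}. card X = l \<and> g X > 0)"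
      "has_neg (sepr_term (map_mat complex_of_real A) l) \<longleftrightarrow> (\<exists>X\<subseteq>{..<n}. card X = l \<and> g X < 0)"
      "has_zero (sepr_term (map_mat complex_of_real A) l) \<longleftrightarrow> (\<exists>X\<subseteq>{..<n}. card X = l \<and> g X = 0)"
      unfolding R(1) signs_of_symbol_of_signs[OF R(2)] by (auto simp: g_def f_eq n_def)
  qed
  have k': "Suc k \<le> n" "Suc (Suc k) \<le> n" "Suc (Suc (Suc k)) \<le> n" using k by (simp_all add: n_def)
  note sN = signs[OF k'(1), folded Nbc(1)] and sb = signs[OF k'(2), folded Nbc(2)]
    and sc = signs[OF k'(3), folded Nbc(3)]
  have zero: "principal_minor f X = 0" if "X \<subseteq> {..<n}" "card X = Suc k" for X
  proof -
    have "\<not> has_pos N" "\<not> has_neg N" by (simp_all add: has_pos_def has_neg_def)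
    then have "\<not> g X > 0" "\<not> g X < 0" using that unfolding sN by blast+
    then show ?thesis unfolding g_def by linarith
  qed
  show "\<not> has_zero c" if "b = A_plus \<or> b = A_minus"
  proof -
    have "\<not> has_zero b" using that by (auto simp: has_zero_def)
    then have "principal_minor f X \<noteq> 0" if "X \<subseteq> {..<n}" "card X = Suc (Suc k)" for X
      using that unfolding sb g_def by blast
    then show ?thesis
      using real_symmetric_nonzero_after_N_A[OF sym zero] unfolding sc g_def by blast
  qed
  show "c \<noteq> A_star" if b: "b = A_plus"
  proof
    assume c: "c = A_star"
    have "\<not> has_zero b" "\<not> has_neg b" using b by (simp_all add: has_zero_def has_neg_def)
    then have "principal_minor f X > 0" if "X \<subseteq> {..<n}" "card X = Suc (Suc k)" for X
      using that unfolding sb g_def by (metis linorder_cases)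
    moreover have "\<not> has_zero c" "has_pos c" "has_neg c"
      using c by (simp_all add: has_zero_def has_pos_def has_neg_def)
    moreover have "principal_minor f X \<noteq> 0" if "X \<subseteq> {..<n}" "card X = Suc (Suc (Suc k))" for X
      using \<open>\<not> has_zero c\<close> that unfolding sc g_def by blast
    ultimately show False
      using real_symmetric_no_sign_change_after_N_A_plus[OF sym zero] unfolding sc g_def by blast
  qed
qed

section \<open>Computing the sepr-sequence of an integer matrix\<close>
fun picks :: "'a list \<Rightarrow> ('a \<times> 'a list) list" where
  "picks [] = []"
| "picks (x # xs) = (x, xs) # map (\<lambda>(y, ys). (y, x # ys)) (picks xs)"

lemma length_picks [simp]: "length (picks xs) = length xs"
  by (induction xs) simp_all

lemma nth_picks: "j < length xs \<Longrightarrow> picks xs ! j = (xs ! j, take j xs @ drop (Suc j) xs)"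
proof (induction xs arbitrary: j)
  case (Cons x xs)
  then show ?case by (cases j) simp_all
qed simp

fun alternating_sum :: "int list \<Rightarrow> int" where
  "alternating_sum [] = 0"
| "alternating_sum (x # xs) = x - alternating_sum xs"

lemma alternating_sum_eq: "alternating_sum xs = (\<Sum>j<length xs. (- 1) ^ j * xs ! j)"
  by (induction xs) (simp_all add: sum.lessThan_Suc_shift sum_negf del: sum.lessThan_Suc)

text \<open>
  Laplace expansion along the first row. The first argument lists the rows and the second the
  columns that are still present; the recursion is on the rows, and zero entries are skipped, so
  that the simplifier evaluates only the minors that contribute.
\<close>
fun laplace_det :: "int list list \<Rightarrow> nat list \<Rightarrow> int" where
  "laplace_det [] cs = 1"
| "laplace_det (r # R) cs = alternating_sum
     (map (\<lambda>(c, cs'). if r ! c = 0 then 0 else r ! c * laplace_det R cs') (picks cs))"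

lemma laplace_det_eq:
  "length R = k \<Longrightarrow> length cs = k \<Longrightarrow> laplace_det R cs = det (mat k k (\<lambda>(i, j). R ! i ! (cs ! j)))"
proof (induction R arbitrary: k cs)
  case Nil
  then show ?case by simp
next
  case (Cons r R)
  then obtain l where k: "k = Suc l" by auto
  let ?A = "mat k k (\<lambda>(i, j). (r # R) ! i ! (cs ! j))"
  have minor: "cofactor ?A 0 j = (- 1) ^ j * laplace_det R (take j cs @ drop (Suc j) cs)" if "j < k" for j
  proof -
    have "mat_delete ?A 0 j = mat l l (\<lambda>(i, m). R ! i ! ((take j cs @ drop (Suc j) cs) ! m))"
      using that Cons.prems k by (intro eq_matI) (auto simp: mat_delete_def nth_append)
    moreover have "laplace_det R (take j cs @ drop (Suc j) cs)
        = det (mat l l (\<lambda>(i, m). R ! i ! ((take j cs @ drop (Suc j) cs) ! m)))"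
      using Cons.prems k that by (intro Cons.IH) simp_all
    ultimately show ?thesis by (simp add: cofactor_def)
  qed
  have "det ?A = (\<Sum>j<k. ?A $$ (0, j) * cofactor ?A 0 j)"
    using k by (intro laplace_expansion_row[of _ k]) simp_all
  also have "\<dots> = (\<Sum>j<k. (- 1) ^ j * (r ! (cs ! j) * laplace_det R (take j cs @ drop (Suc j) cs)))"
  proof (intro sum.cong refl)
    fix j assume "j \<in> {..<k}"
    then have j: "j < k" by simp
    then have "?A $$ (0, j) = r ! (cs ! j)" by simp
    then show "?A $$ (0, j) * cofactor ?A 0 j
        = (- 1) ^ j * (r ! (cs ! j) * laplace_det R (take j cs @ drop (Suc j) cs))"
      unfolding minor[OF j] by (simp only: mult.left_commute)
  qed
  also have "\<dots> = laplace_det (r # R) cs"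
    using Cons.prems by (auto simp: alternating_sum_eq nth_picks intro!: sum.cong)
  finally show ?case by simp
qed

definition principal_minor_list :: "int list list \<Rightarrow> nat \<Rightarrow> int list" where
  "principal_minor_list M k = map (\<lambda>xs. laplace_det (map ((!) M) xs) xs)
     (filter (\<lambda>xs. length xs = k) (subseqs [0..<length M]))"

lemma set_principal_minor_list:
  "set (principal_minor_list M k)
    = {principal_minor (\<lambda>i j. M ! i ! j) X | X. X \<subseteq> {..<length M} \<and> card X = k}"
proof -
  let ?n = "length M"
  have minor: "laplace_det (map ((!) M) xs) xs = principal_minor (\<lambda>i j. M ! i ! j) (set xs)"
    if "distinct xs" for xs
  proof -
    have "bij_betw ((!) xs) {0..<length xs} (set xs)"
      using that by (intro bij_betw_nth) auto
    then have "principal_minor (\<lambda>i j. M ! i ! j) (set xs)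
        = det (mat (length xs) (length xs) (\<lambda>(i, j). M ! (xs ! i) ! (xs ! j)))"
      by (rule principal_minor_reindex)
    also have "mat (length xs) (length xs) (\<lambda>(i, j). M ! (xs ! i) ! (xs ! j))
        = mat (length xs) (length xs) (\<lambda>(i, j). map ((!) M) xs ! i ! (xs ! j))"
      by (intro eq_matI) auto
    finally show ?thesis using laplace_det_eq[of "map ((!) M) xs" "length xs" xs] by simp
  qed
  have dist: "distinct xs" if "xs \<in> set (subseqs [0..<?n])" for xs
    using subseqs_distinctD[OF that] by simp
  have "set ` set (subseqs [0..<?n]) = Pow {..<?n}"
    by (simp add: subseqs_powset atLeast0LessThan)
  then have "{X. X \<subseteq> {..<?n} \<and> card X = k} = {X \<in> set ` set (subseqs [0..<?n]). card X = k}"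
    by (simp only: Pow_iff)
  also have "\<dots> = set ` {xs \<in> set (subseqs [0..<?n]). card (set xs) = k}"
    by blast
  also have "{xs \<in> set (subseqs [0..<?n]). card (set xs) = k} = {xs \<in> set (subseqs [0..<?n]). length xs = k}"
    using dist by (intro Collect_cong conj_cong refl) (simp add: distinct_card)
  finally have sets: "{X. X \<subseteq> {..<?n} \<and> card X = k} = set ` {xs \<in> set (subseqs [0..<?n]). length xs = k}" .
  show ?thesis
    unfolding setcompr_eq_image sets image_image principal_minor_list_def set_map set_filter
    by (intro image_cong refl) (simp add: minor dist)
qed

definition symbol_of_minors :: "int list \<Rightarrow> sepr_symbol" where
  "symbol_of_minors L =
     symbol_of_signs (list_ex (\<lambda>x. x > 0) L) (list_ex (\<lambda>x. x < 0) L) (list_ex (\<lambda>x. x = 0) L)"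

definition int_sepr :: "int list list \<Rightarrow> sepr_symbol list" where
  "int_sepr M = map (\<lambda>k. symbol_of_minors (principal_minor_list M k)) [1..<Suc (length M)]"

definition real_mat_of :: "int list list \<Rightarrow> real mat" where
  "real_mat_of M = mat (length M) (length M) (\<lambda>(i, j). of_int (M ! i ! j))"

definition symmetric_list :: "int list list \<Rightarrow> bool" where
  "symmetric_list M \<longleftrightarrow>
     list_all (\<lambda>i. list_all (\<lambda>j. M ! i ! j = M ! j ! i) [0..<length M]) [0..<length M]"

lemma real_symmetric_real_mat_of:
  assumes "symmetric_list M"
  shows "real_symmetric_mat (real_mat_of M)"
proof -
  have "M ! i ! j = M ! j ! i" if "i < length M" "j < length M" for i j
    using assms that by (simp add: symmetric_list_def list_all_iff)
  then show ?thesis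
    unfolding real_symmetric_mat_def real_mat_of_def by (intro conjI eq_matI) simp_all
qed

lemma sepr_real_mat_of:
  assumes M: "symmetric_list M"
  shows "sepr (map_mat complex_of_real (real_mat_of M)) = int_sepr M"
proof -
  let ?n = "length M"
  have dim: "dim_row (real_mat_of M) = ?n" by (simp add: real_mat_of_def)
  have "sepr_term (map_mat complex_of_real (real_mat_of M)) k = symbol_of_minors (principal_minor_list M k)"
    if k: "k \<le> ?n" for k
  proof -
    have k': "k \<le> dim_row (real_mat_of M)" using k dim by simp
    have "principal_minor (\<lambda>i j. real_mat_of M $$ (i, j)) X = of_int (principal_minor (\<lambda>i j. M ! i ! j) X)"
      if "X \<subseteq> {..<?n}" for X
    proof -
      have "principal_minor (\<lambda>i j. real_mat_of M $$ (i, j)) X = principal_minor (\<lambda>i j. of_int (M ! i ! j)) X"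
      proof (rule principal_minor_cong)
        fix i j assume "i \<in> X" "j \<in> X"
        then have "i < ?n" "j < ?n" using that by auto
        then show "real_mat_of M $$ (i, j) = of_int (M ! i ! j)" by (simp add: real_mat_of_def)
      qed
      also have "\<dots> = of_int (principal_minor (\<lambda>i j. M ! i ! j) X)"
        by (rule principal_minor_hom) simp_all
      finally show ?thesis .
    qed
    then have "{principal_minor (\<lambda>i j. real_mat_of M $$ (i, j)) X | X.
          X \<subseteq> {..<dim_row (real_mat_of M)} \<and> card X = k}
        = real_of_int ` set (principal_minor_list M k)"
      unfolding set_principal_minor_list setcompr_eq_image image_image dim by (intro image_cong) simp_all
    note R = this
    have zero: "0 \<in> real_of_int ` S \<longleftrightarrow> 0 \<in> S" for S by force
    show ?thesis
      unfolding real_symmetric_sepr_term(1)[OF real_symmetric_real_mat_of[OF M] k', unfolded R]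
      by (simp add: symbol_of_minors_def list_ex_iff zero)
  qed
  then show ?thesis
    by (simp add: sepr_def int_sepr_def dim del: upt_Suc)
qed

section \<open>Matrices realizing the remaining triples\<close>
fun triples :: "'a list \<Rightarrow> 'a list list" where
  "triples (x # y # z # xs) = [x, y, z] # triples (y # z # xs)"
| "triples xs = []"

lemma sublist_triples: "\<sigma> \<in> set (triples xs) \<Longrightarrow> sublist \<sigma> xs"
proof (induction xs rule: triples.induct)
  case (1 x y z xs)
  have "sublist [x, y, z] (x # y # z # xs)"
    by (simp add: sublist_Cons_right)
  then show ?case using 1 by (auto intro: sublist_Cons_right[THEN iffD2])
qed simp_all

fun verified :: "(int list list \<times> sepr_symbol list) list \<Rightarrow> bool" where
  "verified [] = True"
| "verified ((M, ss) # ws) \<longleftrightarrow> M \<noteq> [] \<and> symmetric_list M \<and> int_sepr M = ss \<and> verified ws"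

lemma verified_append: "verified ws \<Longrightarrow> verified ws' \<Longrightarrow> verified (ws @ ws')"
  by (induction ws rule: verified.induct) simp_all

text \<open>A matrix is used together with its negative.\<close>
definition realized :: "(int list list \<times> sepr_symbol list) list \<Rightarrow> sepr_symbol list list" where
  "realized ws = concat (map (\<lambda>(M, ss). triples ss @ triples (flip_odd ss)) ws)"

lemma occurs_real_symmetric_realized:
  assumes "verified ws" "\<sigma> \<in> set (realized ws)"
  shows "occurs_real_symmetric \<sigma>"
proof -
  obtain M ss where M: "(M, ss) \<in> set ws" and \<sigma>: "\<sigma> \<in> set (triples ss) \<or> \<sigma> \<in> set (triples (flip_odd ss))"
    using assms(2) by (auto simp: realized_def)
  have "M \<noteq> [] \<and> symmetric_list M \<and> int_sepr M = ss"
    using assms(1) M by (induction ws rule: verified.induct) auto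
  then have ne: "M \<noteq> []" and sym: "symmetric_list M" and ss: "int_sepr M = ss" by simp_all
  let ?A = "real_mat_of M"
  have dim: "dim_row ?A > 0" "dim_row (- ?A) > 0" using ne by (simp_all add: real_mat_of_def)
  note A = real_symmetric_real_mat_of[OF sym]
  have s: "sepr (map_mat complex_of_real ?A) = ss" using sepr_real_mat_of[OF sym] ss by simp
  from \<sigma> show ?thesis
  proof
    assume "\<sigma> \<in> set (triples ss)"
    then show ?thesis
      unfolding occurs_real_symmetric_def using A dim(1) s sublist_triples by blast
  next
    assume "\<sigma> \<in> set (triples (flip_odd ss))"
    then have "sublist \<sigma> (sepr (map_mat complex_of_real (- ?A)))"
      using sepr_uminus(2)[OF A] s sublist_triples by metis
    then show ?thesis
      unfolding occurs_real_symmetric_def using sepr_uminus(1)[OF A] dim(2) by blast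
  qed
qed

text \<open>
  The matrices are chosen so that their sequences, and those of their negatives, contain every
  triple that is admissible and not exceptional. Each comes with its sepr-sequence, which
  \<open>verified\<close> recomputes from all principal minors.
\<close>
definition witnesses_three :: "(int list list \<times> sepr_symbol list) list" where
  "witnesses_three = [
     ([[1,-2,-2], [-2,1,-2], [-2,-2,1]],
      [A_plus, A_minus, A_minus]),
     ([[1,1,-1], [1,1,-1], [-1,-1,1]],
      [A_plus, N, N]),
     ([[-2,1,1], [1,-1,1], [1,1,-2]],
      [A_minus, A_plus, A_plus]),
     ([[-1,2,2], [2,-1,-2], [2,-2,-1]],
      [A_minus, A_minus, A_minus]),
     ([[0,-1,1], [-1,0,1], [1,1,0]],
      [N, A_minus, A_minus])]"

lemma verified_witnesses_three: "verified witnesses_three"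
  unfolding witnesses_three_def by code_simp

definition witnesses_four :: "(int list list \<times> sepr_symbol list) list" where
  "witnesses_four = [
     ([[1,0,0,0], [0,1,0,0], [0,0,-1,0], [0,0,0,-1]],
      [A_star, A_star, A_star, A_plus]),
     ([[1,0,0,0], [0,-1,2,0], [0,2,-1,0], [0,0,0,1]],
      [A_star, A_star, A_minus, A_minus]),
     ([[1,2,0,-1], [2,3,-1,0], [0,-1,-1,0], [-1,0,0,-1]],
      [A_star, A_star, S_star, A_plus]),
     ([[1,0,0,1], [0,-1,0,1], [0,0,1,1], [1,1,1,-1]],
      [A_star, S_star, A_star, A_plus]),
     ([[1,-1,0,0], [-1,1,-1,-1], [0,-1,1,0], [0,-1,0,-2]],
      [A_star, S_star, A_minus, A_plus]),
     ([[-1,-1,0,0], [-1,-1,1,0], [0,1,1,0], [0,0,0,1]],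
      [A_star, S_star, S_star, A_plus]),
     ([[1,1,0,0], [1,1,-1,0], [0,-1,1,0], [0,0,0,-1]],
      [A_star, S_star, S_minus, A_plus]),
     ([[1,-2,0,0], [-2,1,-1,0], [0,-1,2,-1], [0,0,-1,1]],
      [A_plus, A_star, S_star, A_minus]),
     ([[2,-1,0,1], [-1,1,0,1], [0,0,1,0], [1,1,0,2]],
      [A_plus, A_plus, A_star, A_minus]),
     ([[2,2,-2,-2], [2,1,3,-3], [-2,3,1,2], [-2,-3,2,1]],
      [A_plus, A_minus, S_star, A_plus]),
     ([[1,2,2,2], [2,1,2,3], [2,2,2,2], [2,3,2,1]],
      [A_plus, A_minus, S_plus, N]),
     ([[1,1,0,0], [1,1,0,2], [0,0,1,0], [0,2,0,1]],
      [A_plus, S_star, S_star, A_minus]),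
     ([[1,1,1,1], [1,1,0,0], [1,0,1,0], [1,0,0,1]],
      [A_plus, S_plus, A_star, A_minus]),
     ([[1,1,-1,0], [1,1,0,1], [-1,0,1,-1], [0,1,-1,1]],
      [A_plus, S_plus, A_minus, A_minus]),
     ([[1,0,1,1], [0,1,0,0], [1,0,1,0], [1,0,0,1]],
      [A_plus, S_plus, S_star, A_minus]),
     ([[1,0,0,0], [0,1,1,0], [0,1,1,0], [0,0,0,1]],
      [A_plus, S_plus, S_plus, N]),
     ([[1,1,2,2], [1,1,2,2], [2,2,1,2], [2,2,2,1]],
      [A_plus, S_minus, S_plus, N]),
     ([[1,-1,-1,-1], [-1,1,2,-1], [-1,2,1,1], [-1,-1,1,1]],
      [A_plus, S_minus, S_minus, N]),
     ([[-1,0,0,0], [0,-1,-2,0], [0,-2,-1,0], [0,0,0,-1]],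
      [A_minus, A_star, A_star, A_minus]),
     ([[-1,0,0,2], [0,-1,-2,0], [0,-2,-1,0], [2,0,0,-1]],
      [A_minus, A_star, A_plus, A_plus]),
     ([[-1,-1,-2,0], [-1,-2,1,1], [-2,1,-1,0], [0,1,0,-1]],
      [A_minus, A_star, S_plus, A_minus]),
     ([[-3,-1,-1,1], [-1,-1,0,0], [-1,0,-1,0], [1,0,0,-1]],
      [A_minus, A_plus, A_minus, N]),
     ([[-1,0,0,1], [0,-1,1,1], [0,1,-2,1], [1,1,1,-2]],
      [A_minus, A_plus, S_star, A_minus]),
     ([[-2,1,1,1], [1,-1,1,0], [1,1,-2,1], [1,0,1,-1]],
      [A_minus, A_plus, S_plus, A_minus]),
     ([[-1,0,1,0], [0,-1,0,0], [1,0,-2,1], [0,0,1,-1]],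
      [A_minus, A_plus, S_minus, N]),
     ([[-1,-2,-2,-2], [-2,-1,-2,2], [-2,-2,-1,-2], [-2,2,-2,-1]],
      [A_minus, A_minus, A_star, A_plus]),
     ([[-3,-2,-5,2], [-2,-1,-2,-2], [-5,-2,-3,2], [2,-2,2,-1]],
      [A_minus, A_minus, S_plus, A_plus]),
     ([[-1,1,1,1], [1,-1,1,1], [1,1,-1,1], [1,1,1,-1]],
      [A_minus, N, A_plus, A_minus]),
     ([[-1,-1,1,1], [-1,-1,1,-1], [1,1,-1,1], [1,-1,1,-1]],
      [A_minus, N, S_plus, N]),
     ([[-1,1,0,0], [1,-1,-1,-2], [0,-1,-1,0], [0,-2,0,-1]],
      [A_minus, S_star, A_star, A_minus]),
     ([[-1,0,-1,1], [0,-1,1,1], [-1,1,-1,0], [1,1,0,-1]],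
      [A_minus, S_plus, A_plus, A_plus]),
     ([[-4,-1,0,-2], [-1,-1,-1,0], [0,-1,-1,1], [-2,0,1,-1]],
      [A_minus, S_plus, A_plus, N]),
     ([[-1,1,-1,1], [1,-1,-2,2], [-1,-2,-1,2], [1,2,2,-1]],
      [A_minus, S_minus, A_star, A_plus]),
     ([[-1,1,-2,-2], [1,-1,1,2], [-2,1,-1,-2], [-2,2,-2,-1]],
      [A_minus, S_minus, S_star, A_plus]),
     ([[0,1,-1,1], [1,0,-1,-1], [-1,-1,0,1], [1,-1,1,0]],
      [N, A_minus, A_star, A_plus]),
     ([[0,-1,1,1], [-1,0,1,0], [1,1,0,1], [1,0,1,0]],
      [N, S_minus, S_star, A_plus]),
     ([[0,1,-1,0], [1,0,1,0], [-1,1,0,0], [0,0,0,0]],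
      [N, S_minus, S_minus, N]),
     ([[0,1,-1,-1], [1,2,0,0], [-1,0,-1,0], [-1,0,0,-1]],
      [S_star, A_star, A_star, A_plus]),
     ([[1,0,0,1], [0,-2,0,-1], [0,0,-2,-1], [1,-1,-1,0]],
      [S_star, A_star, A_plus, N]),
     ([[1,1,0,0], [1,0,-1,1], [0,-1,-1,-1], [0,1,-1,1]],
      [S_star, A_star, S_star, A_plus]),
     ([[0,-1,-1,-1], [-1,-1,0,0], [-1,0,-1,0], [-1,0,0,1]],
      [S_star, A_star, S_plus, A_plus]),
     ([[1,0,0,1], [0,1,0,-1], [0,0,-1,0], [1,-1,0,0]],
      [S_star, S_star, A_star, A_plus]),
     ([[-1,0,0,0], [0,0,1,1], [0,1,1,0], [0,1,0,-2]],
      [S_star, S_star, A_plus, A_minus]),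
     ([[0,0,0,-1], [0,1,0,0], [0,0,-1,0], [-1,0,0,1]],
      [S_star, S_star, S_star, A_plus]),
     ([[0,0,0,0], [0,1,0,0], [0,0,-1,0], [0,0,0,1]],
      [S_star, S_star, S_minus, N]),
     ([[0,1,1,0], [1,0,1,0], [1,1,1,1], [0,0,1,-1]],
      [S_star, S_minus, A_plus, N]),
     ([[1,1,0,0], [1,0,1,1], [0,1,1,0], [0,1,0,1]],
      [S_plus, A_star, A_star, A_minus]),
     ([[1,1,-1,0], [1,0,1,-1], [-1,1,0,-1], [0,-1,-1,2]],
      [S_plus, A_star, S_minus, N]),
     ([[0,1,1,1], [1,0,1,1], [1,1,0,-1], [1,1,-1,2]],
      [S_plus, A_minus, S_star, A_plus]),
     ([[0,1,1,1], [1,1,1,1], [1,1,0,2], [1,1,2,0]],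
      [S_plus, A_minus, S_plus, N]),
     ([[0,0,0,0], [0,0,0,0], [0,0,1,0], [0,0,0,0]],
      [S_plus, N, N, N]),
     ([[1,1,0,-1], [1,1,0,1], [0,0,0,0], [-1,1,0,1]],
      [S_plus, N, S_minus, N]),
     ([[0,1,1,0], [1,1,0,0], [1,0,0,1], [0,0,1,1]],
      [S_plus, S_star, A_minus, N]),
     ([[1,0,0,0], [0,1,1,0], [0,1,0,0], [0,0,0,1]],
      [S_plus, S_star, S_star, A_minus]),
     ([[1,0,0,0], [0,0,1,0], [0,1,0,0], [0,0,0,1]],
      [S_plus, S_star, S_minus, A_minus]),
     ([[1,0,0,0], [0,1,0,0], [0,0,1,0], [0,0,0,0]],
      [S_plus, S_plus, S_plus, N]),
     ([[0,1,0,-1], [1,0,0,1], [0,0,1,0], [-1,1,0,0]],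
      [S_plus, S_minus, A_minus, A_minus]),
     ([[1,1,1,0], [1,0,1,0], [1,1,0,0], [0,0,0,0]],
      [S_plus, S_minus, S_plus, N]),
     ([[0,-1,1,-1], [-1,-1,1,0], [1,1,0,1], [-1,0,1,-2]],
      [S_minus, A_star, S_star, A_plus]),
     ([[-1,3,-1,1], [3,-1,1,-1], [-1,1,0,1], [1,-1,1,0]],
      [S_minus, A_minus, A_minus, N]),
     ([[-1,0,1,0], [0,-1,0,0], [1,0,0,1], [0,0,1,-1]],
      [S_minus, S_star, A_star, A_minus]),
     ([[-1,-1,0,0], [-1,-1,0,1], [0,0,0,0], [0,1,0,-1]],
      [S_minus, S_plus, S_plus, N]),
     ([[0,-1,0,1], [-1,-1,-1,0], [0,-1,-1,-1], [1,0,-1,0]],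
      [S_minus, S_minus, A_plus, A_plus]),
     ([[0,0,1,0], [0,-1,1,1], [1,1,0,-1], [0,1,-1,0]],
      [S_minus, S_minus, S_star, A_plus])]"

lemma verified_witnesses_four: "verified witnesses_four"
  unfolding witnesses_four_def by code_simp

definition witnesses_five :: "(int list list \<times> sepr_symbol list) list" where
  "witnesses_five = [
     ([[1,2,3,1,0], [2,-1,0,0,-2], [3,0,1,-1,-2], [1,0,-1,-2,0], [0,-2,-2,0,-1]],
      [A_star, A_star, A_plus, S_plus, N]),
     ([[-2,1,0,1,1], [1,-1,0,1,0], [0,0,1,0,0], [1,1,0,-2,1], [1,0,0,1,-1]],
      [A_star, A_star, S_plus, S_star, A_minus]),
     ([[-2,0,1,1,0], [0,-2,1,1,0], [1,1,-1,0,0], [1,1,0,-1,0], [0,0,0,0,1]],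
      [A_star, A_star, S_plus, S_minus, A_minus]),
     ([[1,-1,0,1,-1], [-1,1,-1,0,0], [0,-1,1,1,1], [1,0,1,-2,0], [-1,0,1,0,1]],
      [A_star, S_star, A_minus, S_plus, N]),
     ([[2,2,2,-2,-1], [2,2,-2,-1,-2], [2,-2,2,-1,-2], [-2,-1,-1,2,0], [-1,-2,-2,0,2]],
      [A_plus, S_plus, A_minus, A_star, A_plus]),
     ([[2,-4,-4,-2,2], [-4,8,5,2,-2], [-4,5,8,-2,5], [-2,2,-2,2,-4], [2,-2,5,-4,8]],
      [A_plus, S_plus, A_minus, S_minus, N]),
     ([[-1,0,0,1,1], [0,-1,1,0,-1], [0,1,-1,1,-1], [1,0,1,-1,0], [1,-1,-1,0,-1]],
      [A_minus, S_plus, S_plus, A_star, A_minus]),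
     ([[0,0,0,1,1], [0,0,1,-1,0], [0,1,0,0,1], [1,-1,0,0,0], [1,0,1,0,0]],
      [N, S_minus, N, A_plus, A_minus]),
     ([[0,1,1,1,1], [1,-1,1,1,1], [1,1,-2,0,1], [1,1,0,1,0], [1,1,1,0,-2]],
      [S_star, A_star, A_plus, S_star, A_minus]),
     ([[0,1,-1,1,-1], [1,-2,0,0,0], [-1,0,-2,0,0], [1,0,0,1,-2], [-1,0,0,-2,1]],
      [S_star, A_star, A_plus, S_minus, A_minus]),
     ([[1,-1,1,0,0], [-1,0,1,-1,-1], [1,1,0,1,1], [0,-1,1,-1,0], [0,-1,1,0,1]],
      [S_star, A_star, S_minus, A_star, A_plus]),
     ([[0,1,-1,-1,-1], [1,2,0,-1,0], [-1,0,-1,-1,0], [-1,-1,-1,0,1], [-1,0,0,1,2]],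
      [S_star, A_star, S_minus, S_plus, A_plus]),
     ([[2,0,0,-1,-1], [0,-1,-1,-1,0], [0,-1,1,-1,1], [-1,-1,-1,0,0], [-1,0,1,0,1]],
      [S_star, S_star, A_minus, S_star, A_plus]),
     ([[1,-1,-2,0,1], [-1,-1,-1,1,-2], [-2,-1,-1,2,-1], [0,1,2,-1,0], [1,-2,-1,0,0]],
      [S_star, S_minus, A_plus, S_plus, A_minus]),
     ([[0,-1,1,1,1], [-1,2,1,-1,1], [1,1,2,1,-1], [1,-1,1,1,-1], [1,1,-1,-1,0]],
      [S_plus, A_star, A_minus, A_star, A_plus]),
     ([[1,0,1,-1,0], [0,1,-1,-1,-1], [1,-1,1,0,-1], [-1,-1,0,0,-1], [0,-1,-1,-1,0]],
      [S_plus, S_star, A_minus, A_star, A_plus]),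
     ([[0,0,0,1,0], [0,0,1,0,0], [0,1,1,0,0], [1,0,0,0,0], [0,0,0,0,1]],
      [S_plus, S_star, S_minus, S_star, A_plus]),
     ([[0,1,0,0,0], [1,1,0,0,0], [0,0,1,0,1], [0,0,0,0,0], [0,0,1,0,0]],
      [S_plus, S_star, S_minus, S_plus, N]),
     ([[1,0,0,0,0], [0,0,-1,0,0], [0,-1,0,0,0], [0,0,0,1,0], [0,0,0,0,0]],
      [S_plus, S_star, S_minus, S_minus, N]),
     ([[1,1,1,0,0], [1,1,0,0,0], [1,0,1,0,0], [0,0,0,1,0], [0,0,0,0,0]],
      [S_plus, S_plus, S_star, S_minus, N]),
     ([[0,1,-1,1,0], [1,0,1,-1,0], [-1,1,1,0,1], [1,-1,0,0,1], [0,0,1,1,1]],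
      [S_plus, S_minus, A_minus, A_star, A_plus]),
     ([[0,0,1,0,1], [0,1,0,1,0], [1,0,0,1,-1], [0,1,1,0,0], [1,0,-1,0,0]],
      [S_plus, S_minus, S_minus, A_star, A_plus]),
     ([[0,0,1,1,1], [0,-1,0,0,1], [1,0,-1,1,0], [1,0,1,0,1], [1,1,0,1,0]],
      [S_minus, S_star, A_plus, S_minus, A_minus]),
     ([[0,0,0,1,1], [0,0,1,1,0], [0,1,-1,0,0], [1,1,0,0,0], [1,0,0,0,-1]],
      [S_minus, S_star, S_plus, A_star, A_minus]),
     ([[-1,-1,0,-1,0], [-1,0,-1,0,0], [0,-1,0,0,1], [-1,0,0,-1,1], [0,0,1,1,-1]],
      [S_minus, S_star, S_plus, N, A_minus])]"

lemma verified_witnesses_five: "verified witnesses_five"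
  unfolding witnesses_five_def by code_simp

definition witnesses_six :: "(int list list \<times> sepr_symbol list) list" where
  "witnesses_six = [
     ([[1,2,-1,2,0,0], [2,1,1,1,0,2], [-1,1,1,-2,-2,1], [2,1,-2,1,1,1], [0,0,-2,1,1,-2], [0,2,1,1,-2,1]],
      [A_plus, S_star, S_minus, A_plus, S_star, A_minus]),
     ([[0,0,-1,0,1,-1], [0,0,1,1,0,0], [-1,1,0,0,0,0], [0,1,0,0,-1,-1], [1,0,0,-1,0,0], [-1,0,0,-1,0,0]],
      [N, S_minus, N, S_plus, S_star, A_minus]),
     ([[0,1,0,0,1,0], [1,0,-1,0,0,0], [0,-1,0,-1,0,0], [0,0,-1,0,-1,0], [1,0,0,-1,0,0], [0,0,0,0,0,0]],
      [N, S_minus, N, S_plus, S_minus, N]),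
     ([[0,0,1,3,0,-1], [0,-1,-1,0,-1,-1], [1,-1,-1,-1,-1,0], [3,0,-1,-1,-1,1], [0,-1,-1,-1,0,0], [-1,-1,0,1,0,-1]],
      [S_minus, S_star, S_plus, A_plus, S_plus, N])]"

lemma verified_witnesses_six: "verified witnesses_six"
  unfolding witnesses_six_def by code_simp
section \<open>The classification\<close>

definition exceptional :: "sepr_symbol \<Rightarrow> sepr_symbol \<Rightarrow> sepr_symbol \<Rightarrow> bool" where
  "exceptional a b c \<longleftrightarrow>
     a = N \<and> ((b = A_plus \<or> b = A_minus) \<and> has_zero c \<or> b = A_plus \<and> c = A_star)"

text \<open>The recursion on the list of triples lets the simplifier evaluate \<open>R\<close> only once.\<close>
fun all_realized :: "sepr_symbol list list \<Rightarrow> sepr_symbol list list \<Rightarrow> bool" where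
  "all_realized R [] = True"
| "all_realized R (\<sigma> # \<sigma>s) \<longleftrightarrow>
     (case \<sigma> of [a, b, c] \<Rightarrow>
        (if hermitian_admissible a b c \<and> \<not> exceptional a b c then \<sigma> \<in> set R else True)
      | _ \<Rightarrow> True) \<and> all_realized R \<sigma>s"

definition all_symbols :: "sepr_symbol list" where
  "all_symbols = [A_star, A_plus, A_minus, N, S_star, S_plus, S_minus]"

lemma in_all_symbols: "s \<in> set all_symbols"
  by (cases s) (simp_all add: all_symbols_def)

definition all_triples :: "sepr_symbol list list" where
  "all_triples = concat (map (\<lambda>a. concat (map (\<lambda>b. map (\<lambda>c. [a, b, c]) all_symbols) all_symbols)) all_symbols)"

lemma in_all_triples: "[a, b, c] \<in> set all_triples"
  using in_all_symbols[of a] in_all_symbols[of b] in_all_symbols[of c]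
  by (auto simp: all_triples_def)

definition witnesses :: "(int list list \<times> sepr_symbol list) list" where
  "witnesses = witnesses_three @ witnesses_four @ witnesses_five @ witnesses_six"

lemma verified_witnesses: "verified witnesses"
  unfolding witnesses_def
  by (intro verified_append verified_witnesses_three verified_witnesses_four
      verified_witnesses_five verified_witnesses_six)

lemma all_realized_witnesses: "all_realized (realized witnesses) all_triples"
  by code_simp

lemma all_realized_member:
  "all_realized R \<sigma>s \<Longrightarrow> [a, b, c] \<in> set \<sigma>s \<Longrightarrow> hermitian_admissible a b c \<Longrightarrow>
    \<not> exceptional a b c \<Longrightarrow>
    [a, b, c] \<in> set R"
proof (induction \<sigma>s)
  case (Cons \<sigma> \<sigma>s)
  from Cons.prems(2) consider "\<sigma> = [a, b, c]" | "[a, b, c] \<in> set \<sigma>s" by auto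
  then show ?case
  proof cases
    case 1
    then show ?thesis using Cons.prems(1,3,4) by (simp split: if_splits)
  next
    case 2
    moreover have "all_realized R \<sigma>s" using Cons.prems(1) by simp
    ultimately show ?thesis using Cons.IH Cons.prems(3,4) by blast
  qed
qed simp

theorem theorem5p4:
  fixes \<sigma> :: "sepr_symbol list"
  assumes "length \<sigma> = 3"
  shows "\<not> occurs_real_symmetric \<sigma> \<longleftrightarrow>
    \<not> occurs_hermitian \<sigma>
    \<or> (\<exists>Z \<in> {N, S_star, S_plus, S_minus}. \<sigma> = [N, A_plus, Z] \<or> \<sigma> = [N, A_minus, Z])
    \<or> \<sigma> = [N, A_plus, A_star]"
proof -
  obtain a b c where \<sigma>: "\<sigma> = [a, b, c]"
    using assms by (auto simp: numeral_3_eq_3 length_Suc_conv)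
  have exc: "((\<exists>Z \<in> {N, S_star, S_plus, S_minus}. \<sigma> = [N, A_plus, Z] \<or> \<sigma> = [N, A_minus, Z])
      \<or> \<sigma> = [N, A_plus, A_star]) \<longleftrightarrow> exceptional a b c"
    unfolding \<sigma> by (auto simp: exceptional_def has_zero_def)
  have "occurs_real_symmetric \<sigma> \<longleftrightarrow> occurs_hermitian \<sigma> \<and> \<not> exceptional a b c"
  proof
    assume real: "occurs_real_symmetric \<sigma>"
    have "\<not> exceptional a b c"
    proof
      assume e: "exceptional a b c"
      then have "occurs_real_symmetric [N, b, c]" using real by (simp add: exceptional_def \<sigma>)
      from occurs_real_symmetric_exceptions[OF this] e show False unfolding exceptional_def by blast
    qed
    then show "occurs_hermitian \<sigma> \<and> \<not> exceptional a b c"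
      using occurs_real_symmetric_imp_hermitian[OF real] by blast
  next
    assume *: "occurs_hermitian \<sigma> \<and> \<not> exceptional a b c"
    then have "hermitian_admissible a b c"
      using occurs_hermitian_admissible unfolding \<sigma> by blast
    then have "\<sigma> \<in> set (realized witnesses)"
      unfolding \<sigma> using * by (intro all_realized_member[OF all_realized_witnesses in_all_triples]) blast+
    then show "occurs_real_symmetric \<sigma>"
      by (rule occurs_real_symmetric_realized[OF verified_witnesses])
  qed
  then show ?thesis using exc by blast
qed

end
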